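(* Let $\varphi$ be a Musielak--Orlicz function on $\Omega\times[0,\infty)$ which is of uniformly lower type $p_\varphi^-$ for some $p_\varphi^-\in(0,\infty)$ and of uniformly upper type $p_\varphi^+$ for some $p_\varphi^+\in(0,\infty)$. Then $$WP_\varphi(\Omega)=WH_{\rm at}^{\varphi,\infty,M}(\Omega)\qquad\text{and}\qquad WQ_\varphi(\Omega)=WH_{\rm at}^{\varphi,\infty,S}(\Omega)$$ with equivalent quasi-norms (i.e. in each case the two sets of martingales coincide and the two quasi-norms are comparable up to positive constants independent of the martingale).
   Context: Setting. $(\Omega,\mathcal F,\mathbb P)$ is a probability space, $\{\mathcal F_n\}_{n\in\mathbb Z_+}$ ($\mathbb Z_+=\{0,1,2,\dots\}$, $\mathbb N=\{1,2,\dots\}$) is an increasing sequence of sub-$\sigma$-algebras of $\mathcal F$, and $\mathbb E_n$ is the conditional expectation given $\mathcal F_n$. Musielak--Orlicz functions. $\varphi:\Omega\times[0,\infty)\to[0,\infty)$ is a Musielak--Orlicz function if $\varphi(\cdot,t)$ is measurable for each $t\in[0,\infty)$ and, for each $x\in\Omega$, $\varphi(x,\cdot)$ is non-decreasing, $\varphi(x,0)=0$, $\varphi(x,t)>0$ for $t\in(0,\infty)$, and $\lim_{t\to\infty}\varphi(x,t)=\infty$. It is of uniformly lower (resp. upper) type $p\in(0,\infty)$ if there is a constant $C_{(p)}>0$ with $\varphi(x,st)\le C_{(p)}s^p\varphi(x,t)$ for all $x\in\Omega$, $t\in[0,\infty)$ and $s\in(0,1)$ (resp. $s\in[1,\infty)$).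 Standing assumption: $\int_\Omega\varphi(x,t)\,d\mathbb P(x)<\infty$ for every $t\in(0,\infty)$. For measurable $E\subseteq\Omega$, $\varphi(E,t):=\int_E\varphi(x,t)\,d\mathbb P(x)$. Weak space. $\|f\|_{WL_\varphi(\Omega)}:=\inf\{\lambda\in(0,\infty):\ \sup_{\alpha\in(0,\infty)}\varphi(\{x\in\Omega:|f(x)|>\alpha\},\alpha/\lambda)\le1\}$, and $WL_\varphi(\Omega)$ is the set of measurable $f$ with $\|f\|_{WL_\varphi(\Omega)}<\infty$. Also $\|f\|_{L^\varphi(\Omega)}:=\inf\{\lambda\in(0,\infty):\int_\Omega\varphi(x,|f(x)|/\lambda)\,d\mathbb P(x)\le1\}$. Martingales. $\mathcal M$ is the set of martingales $f=(f_n)_{n\in\mathbb Z_+}$ with respect to $\{\mathcal F_n\}$ with $f_0=0$; $d_nf:=f_n-f_{n-1}$ for $n\in\mathbb N$; $M(f):=\sup_{n\in\mathbb Z_+}|f_n|$; $S_n(f):=(\sum_{i=1}^n|d_if|^2)^{1/2}$; $S(f):=(\sum_{i=1}^\infty|d_if|^2)^{1/2}$. Let $\Lambda$ be the set of sequences $(\lambda_n)_{n\in\mathbb Z_+}$ of nonnegative functions, nondecreasing in $n$, with $\lambda_n$ being $\mathcal F_n$-measurable; $\lambda_\infty:=\lim_{n\to\infty}\lambda_n$. For $f\in\mathcal M$ let $\Lambda[WP_\varphi](f)$ (resp. $\Lambda[WQ_\varphi](f)$) be the set of $(\lambda_n)\in\Lambda$ with $|f_n|\le\lambda_{n-1}$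 (resp. $S_n(f)\le\lambda_{n-1}$) for all $n\in\mathbb N$ and $\lambda_\infty\in WL_\varphi(\Omega)$. $WP_\varphi(\Omega)$ (resp. $WQ_\varphi(\Omega)$) is the set of $f\in\mathcal M$ for which $\|f\|_{WP_\varphi(\Omega)}:=\inf_{(\lambda_n)\in\Lambda[WP_\varphi](f)}\|\lambda_\infty\|_{WL_\varphi(\Omega)}$ (resp. $\|f\|_{WQ_\varphi(\Omega)}:=\inf_{(\lambda_n)\in\Lambda[WQ_\varphi](f)}\|\lambda_\infty\|_{WL_\varphi(\Omega)}$) is finite ($\inf\emptyset=\infty$). Atoms. For a stopping time $\nu$ (with values in $\mathbb Z_+\cup\{\infty\}$) let $B_\nu:=\{x\in\Omega:\nu(x)<\infty\}$. An (integrable) measurable function $a$ is a $(\varphi,\infty)_M$-atom (resp. $(\varphi,\infty)_S$-atom) if there is a stopping time $\nu$ (the stopping time associated with $a$) such that (i) for every $n\in\mathbb Z_+$, $a_n:=\mathbb E_n a=0$ on $\{\nu\ge n\}$; (ii) $\|M(a)\|_{L^\infty(\Omega)}\le\|\mathbf 1_{B_\nu}\|_{L^\varphi(\Omega)}^{-1}$ (resp. $\|S(a)\|_{L^\infty(\Omega)}\le\|\mathbf 1_{B_\nu}\|_{L^\varphi(\Omega)}^{-1}$), where $M(a),S(a)$ are those of the martingale $(a_n)_n$. If $\mathbb P(B_\nu)=0$, then all $a_n=0$ a.e. and (ii) is regarded as satisfied. Atomic spaces. Fix a constant $\widetilde C\in(0,\infty)$ (independent of $f$; the equivalence constants may depend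 on it). $WH_{\rm at}^{\varphi,\infty,M}(\Omega)$ (resp. $WH_{\rm at}^{\varphi,\infty,S}(\Omega)$) is the set of $f\in\mathcal M$ for which there is a sequence of $(\varphi,\infty)_M$-atoms (resp. $(\varphi,\infty)_S$-atoms) $\{a^k\}_{k\in\mathbb Z}$ with associated stopping times $\{\nu^k\}_{k\in\mathbb Z}$ such that, for every $n\in\mathbb Z_+$, $f_n=\sum_{k\in\mathbb Z}\mu^ka_n^k$ $\mathbb P$-a.e., where $\mu^k:=\widetilde C2^k\|\mathbf 1_{B_{\nu^k}}\|_{L^\varphi(\Omega)}$, and whose quasi-norm, defined as $\inf\left\{\inf\left\{\lambda\in(0,\infty):\sup_{k\in\mathbb Z}\varphi(B_{\nu^k},2^k/\lambda)\le1\right\}\right\}$ with the outer infimum over all such decompositions of $f$, is finite. *)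

theory Defs
  imports "HOL-Probability.Probability" "HOL-Library.Extended_Nat"
begin

section \<open>Musielak--Orlicz functions\<close>

text \<open>The half-line \<open>[0,\<infinity>)\<close> is represented by the nonnegative reals and \<open>\<Omega>\<close> by \<open>space M\<close>;
  values of \<open>\<phi>\<close> elsewhere are unconstrained. Nonnegativity of \<open>\<phi>\<close> follows from monotonicity
  and \<open>\<phi> x 0 = 0\<close>.\<close>

definition musielak_orlicz :: "'a measure \<Rightarrow> ('a \<Rightarrow> real \<Rightarrow> real) \<Rightarrow> bool" where
  "musielak_orlicz M \<phi> \<longleftrightarrow>
     (\<forall>t\<ge>0. (\<lambda>x. \<phi> x t) \<in> borel_measurable M) \<and>
     (\<forall>x\<in>space M.
        mono_on {0..} (\<phi> x) \<and> \<phi> x 0 = 0 \<and> (\<forall>t>0. \<phi> x t > 0) \<and>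
        filterlim (\<phi> x) at_top at_top)"

definition unif_lower_type :: "'a measure \<Rightarrow> ('a \<Rightarrow> real \<Rightarrow> real) \<Rightarrow> real \<Rightarrow> bool" where
  "unif_lower_type M \<phi> p \<longleftrightarrow>
     (\<exists>C>0. \<forall>x\<in>space M. \<forall>t\<ge>0. \<forall>s\<in>{0<..<1}. \<phi> x (s * t) \<le> C * s powr p * \<phi> x t)"

definition unif_upper_type :: "'a measure \<Rightarrow> ('a \<Rightarrow> real \<Rightarrow> real) \<Rightarrow> real \<Rightarrow> bool" where
  "unif_upper_type M \<phi> p \<longleftrightarrow>
     (\<exists>C>0. \<forall>x\<in>space M. \<forall>t\<ge>0. \<forall>s\<ge>1. \<phi> x (s * t) \<le> C * s powr p * \<phi> x t)"

definition phi_meas :: "'a measure \<Rightarrow> ('a \<Rightarrow> real \<Rightarrow> real) \<Rightarrow> 'a set \<Rightarrow> real \<Rightarrow> ennreal" where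
  "phi_meas M \<phi> E t = (\<integral>\<^sup>+x\<in>E. ennreal (\<phi> x t) \<partial>M)"


section \<open>Quasi-norms\<close>

text \<open>Quasi-norms take values in \<open>ereal\<close>, where \<open>Inf {} = \<infinity>\<close>. The weak quasi-norm is defined
  for extended real functions because the limit of a sequence in \<open>\<Lambda>\<close> may be infinite.\<close>

definition WL_norm :: "'a measure \<Rightarrow> ('a \<Rightarrow> real \<Rightarrow> real) \<Rightarrow> ('a \<Rightarrow> ereal) \<Rightarrow> ereal" where
  "WL_norm M \<phi> f =
     Inf {ereal l |l. l > 0 \<and>
       (SUP \<alpha>\<in>{0<..}. phi_meas M \<phi> {x \<in> space M. \<bar>f x\<bar> > ereal \<alpha>} (\<alpha> / l)) \<le> 1}"

definition WL :: "'a measure \<Rightarrow> ('a \<Rightarrow> real \<Rightarrow> real) \<Rightarrow> ('a \<Rightarrow> ereal) set" where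
  "WL M \<phi> = {f \<in> borel_measurable M. WL_norm M \<phi> f < \<infinity>}"

definition Lphi_norm :: "'a measure \<Rightarrow> ('a \<Rightarrow> real \<Rightarrow> real) \<Rightarrow> ('a \<Rightarrow> real) \<Rightarrow> ereal" where
  "Lphi_norm M \<phi> f =
     Inf {ereal l |l. l > 0 \<and> (\<integral>\<^sup>+x. ennreal (\<phi> x (\<bar>f x\<bar> / l)) \<partial>M) \<le> 1}"

definition Linf_norm :: "'a measure \<Rightarrow> ('a \<Rightarrow> ereal) \<Rightarrow> ereal" where
  "Linf_norm M f = esssup M (\<lambda>x. \<bar>f x\<bar>)"


section \<open>Martingales\<close>

text \<open>Processes are sequences of functions; as usual, identities and inequalities involving
  conditional expectations are understood almost everywhere.\<close>

definition martingales0 :: "'a measure \<Rightarrow> (nat \<Rightarrow> 'a measure) \<Rightarrow> (nat \<Rightarrow> 'a \<Rightarrow> real) set" where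
  "martingales0 M F =
     {f. (\<forall>n. f n \<in> borel_measurable (F n) \<and> integrable M (f n)) \<and>
         (\<forall>m n. m \<le> n \<longrightarrow> (AE x in M. real_cond_exp M (F m) (f n) x = f m x)) \<and>
         (AE x in M. f 0 x = 0)}"

text \<open>Only used for \<open>n \<ge> 1\<close>.\<close>

definition mdiff :: "(nat \<Rightarrow> 'a \<Rightarrow> real) \<Rightarrow> nat \<Rightarrow> 'a \<Rightarrow> real" where
  "mdiff f n x = f n x - f (n - 1) x"

definition maximal_fn :: "(nat \<Rightarrow> 'a \<Rightarrow> real) \<Rightarrow> 'a \<Rightarrow> ereal" where
  "maximal_fn f x = (SUP n. ereal \<bar>f n x\<bar>)"

definition square_fn_upto :: "(nat \<Rightarrow> 'a \<Rightarrow> real) \<Rightarrow> nat \<Rightarrow> 'a \<Rightarrow> real" where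
  "square_fn_upto f n x = sqrt (\<Sum>i=1..n. \<bar>mdiff f i x\<bar>\<^sup>2)"

definition square_fn :: "(nat \<Rightarrow> 'a \<Rightarrow> real) \<Rightarrow> 'a \<Rightarrow> ereal" where
  "square_fn f x =
     (if summable (\<lambda>i. \<bar>mdiff f (Suc i) x\<bar>\<^sup>2)
      then ereal (sqrt (\<Sum>i. \<bar>mdiff f (Suc i) x\<bar>\<^sup>2)) else \<infinity>)"


section \<open>The spaces of predictable martingales\<close>

definition Lambda_seqs :: "'a measure \<Rightarrow> (nat \<Rightarrow> 'a measure) \<Rightarrow> (nat \<Rightarrow> 'a \<Rightarrow> real) set" where
  "Lambda_seqs M F =
     {l. (\<forall>n. l n \<in> borel_measurable (F n)) \<and>
         (\<forall>x\<in>space M. (\<forall>n. 0 \<le> l n x) \<and> incseq (\<lambda>n. l n x))}"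

definition seq_limit :: "(nat \<Rightarrow> 'a \<Rightarrow> real) \<Rightarrow> 'a \<Rightarrow> ereal" where
  "seq_limit l x = lim (\<lambda>n. ereal (l n x))"

definition Lambda_WP ::
  "'a measure \<Rightarrow> (nat \<Rightarrow> 'a measure) \<Rightarrow> ('a \<Rightarrow> real \<Rightarrow> real) \<Rightarrow> (nat \<Rightarrow> 'a \<Rightarrow> real) \<Rightarrow>
     (nat \<Rightarrow> 'a \<Rightarrow> real) set" where
  "Lambda_WP M F \<phi> f =
     {l \<in> Lambda_seqs M F.
        (\<forall>n\<ge>1. AE x in M. \<bar>f n x\<bar> \<le> l (n - 1) x) \<and> seq_limit l \<in> WL M \<phi>}"

definition Lambda_WQ ::
  "'a measure \<Rightarrow> (nat \<Rightarrow> 'a measure) \<Rightarrow> ('a \<Rightarrow> real \<Rightarrow> real) \<Rightarrow> (nat \<Rightarrow> 'a \<Rightarrow> real) \<Rightarrow>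
     (nat \<Rightarrow> 'a \<Rightarrow> real) set" where
  "Lambda_WQ M F \<phi> f =
     {l \<in> Lambda_seqs M F.
        (\<forall>n\<ge>1. AE x in M. square_fn_upto f n x \<le> l (n - 1) x) \<and> seq_limit l \<in> WL M \<phi>}"

definition WP_norm ::
  "'a measure \<Rightarrow> (nat \<Rightarrow> 'a measure) \<Rightarrow> ('a \<Rightarrow> real \<Rightarrow> real) \<Rightarrow> (nat \<Rightarrow> 'a \<Rightarrow> real) \<Rightarrow> ereal" where
  "WP_norm M F \<phi> f = (INF l\<in>Lambda_WP M F \<phi> f. WL_norm M \<phi> (seq_limit l))"

definition WQ_norm ::
  "'a measure \<Rightarrow> (nat \<Rightarrow> 'a measure) \<Rightarrow> ('a \<Rightarrow> real \<Rightarrow> real) \<Rightarrow> (nat \<Rightarrow> 'a \<Rightarrow> real) \<Rightarrow> ereal" where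
  "WQ_norm M F \<phi> f = (INF l\<in>Lambda_WQ M F \<phi> f. WL_norm M \<phi> (seq_limit l))"

definition WP ::
  "'a measure \<Rightarrow> (nat \<Rightarrow> 'a measure) \<Rightarrow> ('a \<Rightarrow> real \<Rightarrow> real) \<Rightarrow> (nat \<Rightarrow> 'a \<Rightarrow> real) set" where
  "WP M F \<phi> = {f \<in> martingales0 M F. WP_norm M F \<phi> f < \<infinity>}"

definition WQ ::
  "'a measure \<Rightarrow> (nat \<Rightarrow> 'a measure) \<Rightarrow> ('a \<Rightarrow> real \<Rightarrow> real) \<Rightarrow> (nat \<Rightarrow> 'a \<Rightarrow> real) set" where
  "WQ M F \<phi> = {f \<in> martingales0 M F. WQ_norm M F \<phi> f < \<infinity>}"


section \<open>Atoms and atomic spaces\<close>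

text \<open>The library's \<open>stopping_time\<close> requires the values to lie in the index set of the
  filtration, so it does not cover the value \<open>\<infinity>\<close>.\<close>

definition ext_stopping_time :: "'a measure \<Rightarrow> (nat \<Rightarrow> 'a measure) \<Rightarrow> ('a \<Rightarrow> enat) \<Rightarrow> bool" where
  "ext_stopping_time M F \<nu> \<longleftrightarrow> (\<forall>n. {x \<in> space M. \<nu> x \<le> enat n} \<in> sets (F n))"

definition B_set :: "'a measure \<Rightarrow> ('a \<Rightarrow> enat) \<Rightarrow> 'a set" where
  "B_set M \<nu> = {x \<in> space M. \<nu> x < \<infinity>}"

definition cond_mart :: "'a measure \<Rightarrow> (nat \<Rightarrow> 'a measure) \<Rightarrow> ('a \<Rightarrow> real) \<Rightarrow> nat \<Rightarrow> 'a \<Rightarrow> real" where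
  "cond_mart M F a n = real_cond_exp M (F n) a"

text \<open>The parameter \<open>T\<close> is the operator in the size condition; it is \<open>maximal_fn\<close> for
  \<open>(\<phi>,\<infinity>)\<^sub>M\<close>-atoms and \<open>square_fn\<close> for \<open>(\<phi>,\<infinity>)\<^sub>S\<close>-atoms. If \<open>B_set M \<nu>\<close> is a null set, then
  the norm of its indicator is \<open>0\<close>, and since \<open>inverse 0 = \<infinity>\<close> in \<open>ereal\<close> the size condition
  holds trivially.\<close>

definition atom ::
  "((nat \<Rightarrow> 'a \<Rightarrow> real) \<Rightarrow> 'a \<Rightarrow> ereal) \<Rightarrow> 'a measure \<Rightarrow> (nat \<Rightarrow> 'a measure) \<Rightarrow>
     ('a \<Rightarrow> real \<Rightarrow> real) \<Rightarrow> ('a \<Rightarrow> real) \<Rightarrow> ('a \<Rightarrow> enat) \<Rightarrow> bool" where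
  "atom T M F \<phi> a \<nu> \<longleftrightarrow>
     integrable M a \<and> ext_stopping_time M F \<nu> \<and>
     (\<forall>n. AE x in M. enat n \<le> \<nu> x \<longrightarrow> cond_mart M F a n x = 0) \<and>
     Linf_norm M (T (cond_mart M F a)) \<le> inverse (Lphi_norm M \<phi> (indicator (B_set M \<nu>)))"

definition atom_coeff ::
  "'a measure \<Rightarrow> ('a \<Rightarrow> real \<Rightarrow> real) \<Rightarrow> real \<Rightarrow> (int \<Rightarrow> 'a \<Rightarrow> enat) \<Rightarrow> int \<Rightarrow> real" where
  "atom_coeff M \<phi> C \<nu> k =
     C * 2 powi k * real_of_ereal (Lphi_norm M \<phi> (indicator (B_set M (\<nu> k))))"

text \<open>The series over \<open>\<int>\<close> is read as an unconditionally convergent sum (\<open>has_sum\<close>).\<close>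

definition atomic_decomp ::
  "((nat \<Rightarrow> 'a \<Rightarrow> real) \<Rightarrow> 'a \<Rightarrow> ereal) \<Rightarrow> 'a measure \<Rightarrow> (nat \<Rightarrow> 'a measure) \<Rightarrow>
     ('a \<Rightarrow> real \<Rightarrow> real) \<Rightarrow> real \<Rightarrow> (nat \<Rightarrow> 'a \<Rightarrow> real) \<Rightarrow>
     (int \<Rightarrow> 'a \<Rightarrow> real) \<Rightarrow> (int \<Rightarrow> 'a \<Rightarrow> enat) \<Rightarrow> bool" where
  "atomic_decomp T M F \<phi> C f a \<nu> \<longleftrightarrow>
     (\<forall>k. atom T M F \<phi> (a k) (\<nu> k)) \<and>
     (\<forall>n. AE x in M.
        ((\<lambda>k. atom_coeff M \<phi> C \<nu> k * cond_mart M F (a k) n x) has_sum f n x) UNIV)"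

definition WH_at_norm ::
  "((nat \<Rightarrow> 'a \<Rightarrow> real) \<Rightarrow> 'a \<Rightarrow> ereal) \<Rightarrow> 'a measure \<Rightarrow> (nat \<Rightarrow> 'a measure) \<Rightarrow>
     ('a \<Rightarrow> real \<Rightarrow> real) \<Rightarrow> real \<Rightarrow> (nat \<Rightarrow> 'a \<Rightarrow> real) \<Rightarrow> ereal" where
  "WH_at_norm T M F \<phi> C f =
     Inf {Inf {ereal l |l. l > 0 \<and> (SUP k. phi_meas M \<phi> (B_set M (\<nu> k)) (2 powi k / l)) \<le> 1} |a \<nu>.
       atomic_decomp T M F \<phi> C f a \<nu>}"

definition WH_at ::
  "((nat \<Rightarrow> 'a \<Rightarrow> real) \<Rightarrow> 'a \<Rightarrow> ereal) \<Rightarrow> 'a measure \<Rightarrow> (nat \<Rightarrow> 'a measure) \<Rightarrow>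
     ('a \<Rightarrow> real \<Rightarrow> real) \<Rightarrow> real \<Rightarrow> (nat \<Rightarrow> 'a \<Rightarrow> real) set" where
  "WH_at T M F \<phi> C =
     {f \<in> martingales0 M F.
        (\<exists>a \<nu>. atomic_decomp T M F \<phi> C f a \<nu>) \<and> WH_at_norm T M F \<phi> C f < \<infinity>}"

definition equiv_on :: "'b set \<Rightarrow> ('b \<Rightarrow> ereal) \<Rightarrow> ('b \<Rightarrow> ereal) \<Rightarrow> bool" where
  "equiv_on A N N' \<longleftrightarrow>
     (\<exists>c1>0. \<exists>c2>0. \<forall>f\<in>A. ereal c1 * N' f \<le> N f \<and> N f \<le> ereal c2 * N' f)"

end

theory Submission
  imports Defs
begin

text \<open>
  Given a majorizing sequence \<open>l\<close> of \<open>f\<close>, slice \<open>f\<close> by the predictable sets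
  \<open>{\<theta> k < l (i - 1) \<le> 2 * \<theta> k}\<close> with \<open>\<theta> k = C / 3 * 2 powi k\<close>. Each slice is a martingale transform, equal
  to the difference of \<open>f\<close> stopped at the first times \<open>l\<close> exceeds \<open>2 * \<theta> k\<close> and \<open>\<theta> k\<close>, whose
  maximal or square function is at most \<open>3 * \<theta> k = C * 2 powi k\<close>. It is therefore bounded in
  \<open>L\<^sup>2\<close> and closed by an integrable function, which is a multiple of an atom. At every time and
  point only finitely many slices are nonzero, so the sum over \<open>k\<close> converges unconditionally to \<open>f\<close>.

  Conversely, the atoms give the majorant \<open>\<Sum>k. C * 2 powi k * indicator {\<nu> k \<le> n}\<close>. Since
  \<open>\<Sum>k<j. 2 powi k = 2 powi j\<close>, its limit exceeds \<open>C * 2 powi j\<close> only on the union of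
  the sets \<open>{\<nu> k < \<infinity>}\<close> with \<open>k \<ge> j\<close>, and the lower type of \<open>\<phi>\<close> makes the sum of their
  weak-type bounds a convergent geometric series.
\<close>

section \<open>Martingale transforms and closed martingales\<close>

locale prob_filtration = prob_space M for M :: "'a measure" +
  fixes F :: "nat \<Rightarrow> 'a measure"
  assumes filtration: "filtration (space M) F"
    and subalg: "\<And>n. subalgebra M (F n)"
begin

section \<open>Measurability along the filtration and the martingale property\<close>

lemma cond_exp_locale: "sigma_finite_subalgebra M (F n)"
proof -
  interpret finite_measure_subalgebra M "F n"
    using subalg by unfold_locales
  show ?thesis by unfold_locales
qed

lemma space_F: "space (F n) = space M"
  using filtration by (simp add: filtration_def)

lemma measurable_F_M: "f \<in> borel_measurable (F n) \<Longrightarrow> f \<in> borel_measurable M"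
  using measurable_from_subalg[OF subalg] .

lemma sets_F_M: "A \<in> sets (F n) \<Longrightarrow> A \<in> sets M"
  using subalg by (auto simp: subalgebra_def)

lemma measurable_F_mono: "m \<le> n \<Longrightarrow> f \<in> borel_measurable (F m) \<Longrightarrow> f \<in> borel_measurable (F n)"
  using filtration by (intro measurable_from_subalg[of "F n" "F m"])
    (auto simp: subalgebra_def filtration_def)

lemma martingaleD:
  assumes "f \<in> martingales0 M F"
  shows "f n \<in> borel_measurable (F n)" "f n \<in> borel_measurable M" "integrable M (f n)"
    "m \<le> n \<Longrightarrow> AE x in M. real_cond_exp M (F m) (f n) x = f m x" "AE x in M. f 0 x = 0"
  using assms measurable_F_M by (auto simp: martingales0_def)

text \<open>Being measurable for \<open>F m\<close>, the factor \<open>u\<close> passes through the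
  conditional expectation. Every later use of the martingale property goes through this identity,
  with \<open>u\<close> an indicator, an indicator times a weight, or the martingale itself.\<close>

lemma martingale_integral_mult:
  assumes f: "f \<in> martingales0 M F" and "m \<le> n" and u: "u \<in> borel_measurable (F m)"
    and int: "integrable M (\<lambda>x. u x * f n x)"
  shows "(\<integral>x. u x * f n x \<partial>M) = (\<integral>x. u x * f m x \<partial>M)"
proof -
  interpret sigma_finite_subalgebra M "F m" by (rule cond_exp_locale)
  note [measurable] = measurable_F_M[OF u] martingaleD(2)[OF f]
  have "(\<integral>x. u x * f n x \<partial>M) = (\<integral>x. u x * real_cond_exp M (F m) (f n) x \<partial>M)"
    by (intro real_cond_exp_intg(2)[symmetric] int u) measurable
  also have "\<dots> = (\<integral>x. u x * f m x \<partial>M)"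
    using martingaleD(4)[OF f \<open>m \<le> n\<close>] by (intro integral_cong_AE) auto
  finally show ?thesis .
qed

end

section \<open>Transforms by predictable weights\<close>

definition martingale_transform ::
  "(nat \<Rightarrow> 'a \<Rightarrow> real) \<Rightarrow> (nat \<Rightarrow> 'a \<Rightarrow> real) \<Rightarrow> nat \<Rightarrow> 'a \<Rightarrow> real" where
  "martingale_transform w f n x = (\<Sum>i=1..n. w (i - 1) x * mdiff f i x)"

lemma martingale_transform_0 [simp]: "martingale_transform w f 0 x = 0"
  by (simp add: martingale_transform_def)

lemma martingale_transform_Suc:
  "martingale_transform w f (Suc n) x =
     martingale_transform w f n x + w n x * (f (Suc n) x - f n x)"
  by (simp add: martingale_transform_def mdiff_def)

lemma mdiff_martingale_transform:
  "i \<ge> 1 \<Longrightarrow> mdiff (martingale_transform w f) i x = w (i - 1) x * mdiff f i x"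
  by (cases i) (simp_all add: martingale_transform_Suc mdiff_def)

text \<open>The bound on the weights keeps all terms integrable. Since \<open>w n\<close> is known
  at time \<open>n\<close>, each added increment integrates to zero over every set of
  \<open>F m\<close> with \<open>m \<le> n\<close>, which characterizes the conditional
  expectation.\<close>

lemma (in prob_filtration) martingale_transform_martingale:
  assumes f: "f \<in> martingales0 M F"
    and w: "\<And>n. w n \<in> borel_measurable (F n)" and bound: "\<And>n x. \<bar>w n x\<bar> \<le> 1"
  shows "martingale_transform w f \<in> martingales0 M F"
proof -
  let ?g = "martingale_transform w f"
  have meas: "?g n \<in> borel_measurable (F n)" for n
  proof (induction n)
    case (Suc n)
    note [measurable] = measurable_F_mono[OF _ Suc, of "Suc n"] martingaleD(1)[OF f, of "Suc n"]
      measurable_F_mono[OF _ martingaleD(1)[OF f, of n], of "Suc n"]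
      measurable_F_mono[OF _ w[of n], of "Suc n"]
    show ?case unfolding martingale_transform_Suc by measurable
  qed (simp add: martingale_transform_def)
  have int_w: "integrable M (\<lambda>x. w n x * f m x)" for n m
  proof (rule Bochner_Integration.integrable_bound[OF martingaleD(3)[OF f, of m]])
    show "(\<lambda>x. w n x * f m x) \<in> borel_measurable M"
      using measurable_F_M[OF w] martingaleD(2)[OF f] by measurable
    show "AE x in M. norm (w n x * f m x) \<le> norm (f m x)"
      using mult_right_mono[OF bound] by (auto simp: abs_mult)
  qed
  have int: "integrable M (?g n)" for n
  proof (induction n)
    case (Suc n)
    then show ?case
      unfolding martingale_transform_Suc right_diff_distrib
      by (intro Bochner_Integration.integrable_add Bochner_Integration.integrable_diff int_w)
  qed (simp add: martingale_transform_def)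
  have "AE x in M. real_cond_exp M (F m) (?g n) x = ?g m x" if "m \<le> n" for m n
  proof -
    interpret sigma_finite_subalgebra M "F m" by (rule cond_exp_locale)
    show ?thesis
    proof (rule real_cond_exp_charact[OF _ int int meas])
      fix A assume A: "A \<in> sets (F m)"
      show "(\<integral>x\<in>A. ?g n x \<partial>M) = (\<integral>x\<in>A. ?g m x \<partial>M)"
        using \<open>m \<le> n\<close>
      proof (induction n rule: dec_induct)
        case (step n)
        have ind: "integrable M (\<lambda>x. indicator A x * h x)" if "integrable M h" for h :: "'a \<Rightarrow> real"
          using integrable_mult_indicator[OF sets_F_M[OF A] that] by simp
        have u: "(\<lambda>x. indicator A x * w n x) \<in> borel_measurable (F n)"
          by (intro borel_measurable_times w measurable_F_mono[OF \<open>m \<le> n\<close>] borel_measurable_indicator A)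
        have eq: "(\<integral>x. indicator A x * (w n x * f (Suc n) x) \<partial>M) = (\<integral>x. indicator A x * (w n x * f n x) \<partial>M)"
          using martingale_integral_mult[OF f le_SucI[OF order.refl] u] ind[OF int_w, of n "Suc n"]
          by (simp add: mult.assoc)
        show ?case
          using step.IH eq ind[OF int, of n] ind[OF int_w, of n n] ind[OF int_w, of n "Suc n"]
          by (simp add: set_lebesgue_integral_def martingale_transform_Suc algebra_simps)
      qed simp
    qed
  qed
  with meas int show ?thesis by (simp add: martingales0_def)
qed

text \<open>Orthogonality of increments: for \<open>m \<le> n\<close> the mixed product
  \<open>g m * g n\<close> has the same integral as the square of \<open>g m\<close>, so expanding
  the square leaves a difference of second moments.\<close>

lemma (in prob_filtration) L2_martingale_increment:
  assumes g: "g \<in> martingales0 M F"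
    and sq: "\<And>n. integrable M (\<lambda>x. (g n x)\<^sup>2)"
  shows "integrable M (\<lambda>x. (g n x - g m x)\<^sup>2)"
    and "m \<le> n \<Longrightarrow> (\<integral>x. (g n x - g m x)\<^sup>2 \<partial>M) = (\<integral>x. (g n x)\<^sup>2 \<partial>M) - (\<integral>x. (g m x)\<^sup>2 \<partial>M)"
proof -
  note [measurable] = martingaleD(2)[OF g]
  have prod: "integrable M (\<lambda>x. g m x * g n x)" for m n
  proof (rule Bochner_Integration.integrable_bound[OF Bochner_Integration.integrable_add[OF sq[of m] sq[of n]]])
    have "\<bar>a * b\<bar> \<le> a\<^sup>2 + b\<^sup>2" for a b :: real
    proof -
      have "2 * (\<bar>a\<bar> * \<bar>b\<bar>) \<le> a\<^sup>2 + b\<^sup>2" using sum_squares_bound[of "\<bar>a\<bar>" "\<bar>b\<bar>"] by simp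
      moreover have "0 \<le> \<bar>a\<bar> * \<bar>b\<bar>" by simp
      ultimately show ?thesis unfolding abs_mult by linarith
    qed
    then show "AE x in M. norm (g m x * g n x) \<le> norm ((g m x)\<^sup>2 + (g n x)\<^sup>2)" by simp
  qed measurable
  show "integrable M (\<lambda>x. (g n x - g m x)\<^sup>2)"
  proof -
    have "integrable M (\<lambda>x. (g n x)\<^sup>2 + (g m x)\<^sup>2 - 2 * (g n x * g m x))"
      by (intro Bochner_Integration.integrable_diff Bochner_Integration.integrable_add integrable_mult_right sq prod)
    then show ?thesis by (simp add: power2_diff mult.assoc)
  qed
  assume "m \<le> n"
  have "(\<integral>x. g m x * g n x \<partial>M) = (\<integral>x. (g m x)\<^sup>2 \<partial>M)"
    using martingale_integral_mult[OF g \<open>m \<le> n\<close> martingaleD(1)[OF g] prod]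
    by (simp add: power2_eq_square)
  moreover have "(\<integral>x. (g n x - g m x)\<^sup>2 \<partial>M) = (\<integral>x. (g n x)\<^sup>2 + (g m x)\<^sup>2 - 2 * (g m x * g n x) \<partial>M)"
    by (simp add: power2_diff algebra_simps)
  ultimately show "(\<integral>x. (g n x - g m x)\<^sup>2 \<partial>M) = (\<integral>x. (g n x)\<^sup>2 \<partial>M) - (\<integral>x. (g m x)\<^sup>2 \<partial>M)"
    using sq prod by simp
qed

text \<open>The second moments increase and stay below \<open>K\<close>, hence are Cauchy, and by
  orthogonality the martingale is Cauchy in L1. Its L1 limit closes it, because integrals over sets
  of \<open>F n\<close> pass to the limit.\<close>

lemma (in prob_filtration) L2_bounded_martingale_closed:
  assumes g: "g \<in> martingales0 M F"
    and sq: "\<And>n. integrable M (\<lambda>x. (g n x)\<^sup>2)"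
    and bound: "\<And>n. (\<integral>x. (g n x)\<^sup>2 \<partial>M) \<le> K"
  obtains a where "integrable M a" "\<And>n. AE x in M. real_cond_exp M (F n) a x = g n x"
proof -
  note [measurable] = martingaleD(2)[OF g]
  note int = martingaleD(3)[OF g]
  define q where "q n = (\<integral>x. (g n x)\<^sup>2 \<partial>M)" for n
  note sqdiff = L2_martingale_increment(1)[OF g sq]
  note qdiff = L2_martingale_increment(2)[OF g sq, folded q_def]
  have "incseq q"
  proof (rule monoI)
    fix m n :: nat assume "m \<le> n"
    have "0 \<le> (\<integral>x. (g n x - g m x)\<^sup>2 \<partial>M)" by simp
    with qdiff[OF \<open>m \<le> n\<close>] show "q m \<le> q n" by simp
  qed
  then have "convergent q"
    by (rule incseq_convergent[of q K]) (use bound in \<open>auto simp: q_def convergent_def\<close>)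
  then have "Cauchy q" by (rule convergent_Cauchy)
  \<comment> \<open>On a probability space the squared mean of an absolute value is at most the mean
    square; this is nonnegativity of the variance.\<close>
  have L1: "(\<integral>x. \<bar>g n x - g m x\<bar> \<partial>M)\<^sup>2 \<le> q n - q m" if "m \<le> n" for m n
  proof -
    have "(\<integral>x. \<bar>g n x - g m x\<bar> \<partial>M)\<^sup>2 \<le> (\<integral>x. (\<bar>g n x - g m x\<bar>)\<^sup>2 \<partial>M)"
    proof -
      have "0 \<le> variance (\<lambda>x. \<bar>g n x - g m x\<bar>)" by (rule integral_nonneg_AE) simp
      also have "\<dots> = (\<integral>x. (\<bar>g n x - g m x\<bar>)\<^sup>2 \<partial>M) - (\<integral>x. \<bar>g n x - g m x\<bar> \<partial>M)\<^sup>2"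
        using int sqdiff by (intro variance_eq) auto
      finally show ?thesis by simp
    qed
    then show ?thesis using qdiff[OF that] by simp
  qed
  have L1C: "\<exists>N. \<forall>i\<ge>N. \<forall>j\<ge>N. (\<integral>x. norm (g i x - g j x) \<partial>M) < e" if e: "e > 0" for e
  proof -
    obtain N where N: "\<And>m n. m \<ge> N \<Longrightarrow> n \<ge> N \<Longrightarrow> \<bar>q m - q n\<bar> < e\<^sup>2"
      using CauchyD[OF \<open>Cauchy q\<close>, of "e\<^sup>2"] e by (metis real_norm_def zero_less_power)
    have *: "(\<integral>x. norm (g i x - g j x) \<partial>M) < e" if "N \<le> j" "j \<le> i" for i j
    proof -
      have "(\<integral>x. \<bar>g i x - g j x\<bar> \<partial>M)\<^sup>2 < e\<^sup>2"
        using L1[OF that(2)] N[of i j] that by linarith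
      then show ?thesis using \<open>e > 0\<close> power_less_imp_less_base[of _ 2 e] by simp
    qed
    show ?thesis
    proof (intro exI allI impI)
      fix i j assume "N \<le> i" "N \<le> j"
      then show "(\<integral>x. norm (g i x - g j x) \<partial>M) < e"
        using *[of i j] *[of j i] by (cases "i \<le> j") (simp_all add: abs_minus_commute[of "g i _" "g j _"])
    qed
  qed
  \<comment> \<open>A subsequence converging almost everywhere supplies a pointwise candidate
    \<open>a\<close>; L1 convergence of the full sequence is recovered below.\<close>
  obtain r where r: "strict_mono r" "AE x in M. Cauchy (\<lambda>i. g (r i) x)"
    by (rule cauchy_L1_AE_cauchy_subseq[OF int L1C]) auto
  define a where "a x = lim (\<lambda>i. g (r i) x)" for x
  have [measurable]: "a \<in> borel_measurable M" unfolding a_def by measurable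
  have lim: "AE x in M. (\<lambda>i. g (r i) x) \<longlonglongrightarrow> a x"
    using r(2) by eventually_elim (simp add: a_def Cauchy_convergent_iff convergent_LIMSEQ_iff)
  \<comment> \<open>Fatou's lemma lets one index of the Cauchy estimate run to infinity along the
    subsequence. The bound is on the nonnegative integral because \<open>a\<close> is not yet known
    to be integrable.\<close>
  have fatou: "\<exists>N. \<forall>m\<ge>N. (\<integral>\<^sup>+x. ennreal \<bar>a x - g m x\<bar> \<partial>M) \<le> ennreal e" if e: "e > 0" for e
  proof -
    obtain N where N: "\<And>i j. i \<ge> N \<Longrightarrow> j \<ge> N \<Longrightarrow> (\<integral>x. \<bar>g i x - g j x\<bar> \<partial>M) < e"
      using L1C[OF e] by auto
    show ?thesis
    proof (intro exI allI impI)
      fix m assume "N \<le> m"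
      have "(\<integral>\<^sup>+x. ennreal \<bar>a x - g m x\<bar> \<partial>M) = (\<integral>\<^sup>+x. liminf (\<lambda>i. ennreal \<bar>g (r i) x - g m x\<bar>) \<partial>M)"
      proof (intro nn_integral_cong_AE, use lim in eventually_elim)
        fix x assume "(\<lambda>i. g (r i) x) \<longlonglongrightarrow> a x"
        then have "(\<lambda>i. ennreal \<bar>g (r i) x - g m x\<bar>) \<longlonglongrightarrow> ennreal \<bar>a x - g m x\<bar>"
          by (intro tendsto_intros) auto
        then show "ennreal \<bar>a x - g m x\<bar> = liminf (\<lambda>i. ennreal \<bar>g (r i) x - g m x\<bar>)"
          by (rule lim_imp_Liminf[OF sequentially_bot, symmetric])
      qed
      also have "\<dots> \<le> liminf (\<lambda>i. \<integral>\<^sup>+x. ennreal \<bar>g (r i) x - g m x\<bar> \<partial>M)"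
        by (intro nn_integral_liminf) measurable
      also have "\<dots> \<le> ennreal e"
      proof (rule Liminf_le[OF sequentially_bot])
        show "\<forall>\<^sub>F i in sequentially. (\<integral>\<^sup>+x. ennreal \<bar>g (r i) x - g m x\<bar> \<partial>M) \<le> ennreal e"
          using eventually_ge_at_top[of N]
        proof eventually_elim
          case (elim i)
          then have "r i \<ge> N" using seq_suble[OF r(1), of i] by linarith
          then have "ennreal (\<integral>x. \<bar>g (r i) x - g m x\<bar> \<partial>M) \<le> ennreal e"
            using N[of "r i" m] \<open>N \<le> m\<close> by (intro ennreal_leI) auto
          then show ?case using int by (subst nn_integral_eq_integral) auto
        qed
      qed
      finally show "(\<integral>\<^sup>+x. ennreal \<bar>a x - g m x\<bar> \<partial>M) \<le> ennreal e" .
    qed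
  qed
  have int_diff: "\<exists>N. \<forall>m\<ge>N. integrable M (\<lambda>x. a x - g m x)"
  proof -
    obtain N where N: "\<forall>m\<ge>N. (\<integral>\<^sup>+x. ennreal \<bar>a x - g m x\<bar> \<partial>M) \<le> ennreal 1" using fatou[of 1] by auto
    have "integrable M (\<lambda>x. a x - g m x)" if "m \<ge> N" for m
      using le_less_trans[OF N[rule_format, OF that] ennreal_less_top]
      by (intro integrableI_bounded) auto
    then show ?thesis by blast
  qed
  have "integrable M a"
  proof -
    obtain N where "integrable M (\<lambda>x. a x - g N x)" using int_diff by auto
    then have "integrable M (\<lambda>x. (a x - g N x) + g N x)" by (intro Bochner_Integration.integrable_add int)
    then show ?thesis by simp
  qed
  moreover have "AE x in M. real_cond_exp M (F n) a x = g n x" for n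
  proof -
    interpret sigma_finite_subalgebra M "F n" by (rule cond_exp_locale)
    show ?thesis
    proof (rule real_cond_exp_charact[OF _ \<open>integrable M a\<close> int martingaleD(1)[OF g]])
      fix A assume A: "A \<in> sets (F n)"
      then have AM [measurable]: "A \<in> sets M" by (rule sets_F_M)
      have ind: "integrable M (\<lambda>x. indicator A x * h x)" if "integrable M h" for h :: "'a \<Rightarrow> real"
        using integrable_mult_indicator[OF AM that] by simp
      \<comment> \<open>Over \<open>A\<close> the integral of \<open>g n\<close> agrees with that of
        any later \<open>g m\<close>, and \<open>g m\<close> can be taken within \<open>e\<close> of
        \<open>a\<close> in L1.\<close>
      have "\<bar>(\<integral>x. indicator A x * a x \<partial>M) - (\<integral>x. indicator A x * g n x \<partial>M)\<bar> \<le> e" if e: "e > 0" for e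
      proof -
        obtain N where N: "\<forall>m\<ge>N. (\<integral>\<^sup>+x. ennreal \<bar>a x - g m x\<bar> \<partial>M) \<le> ennreal e" using fatou[OF e] by auto
        define m where "m = max n N"
        have eq: "(\<integral>x. indicator A x * g n x \<partial>M) = (\<integral>x. indicator A x * g m x \<partial>M)"
          using A by (intro martingale_integral_mult[OF g, symmetric] ind int) (auto simp: m_def)
        have "\<bar>(\<integral>x. indicator A x * a x \<partial>M) - (\<integral>x. indicator A x * g n x \<partial>M)\<bar> =
            \<bar>\<integral>x. indicator A x * (a x - g m x) \<partial>M\<bar>"
          unfolding eq using ind[OF int] ind[OF \<open>integrable M a\<close>] by (simp add: right_diff_distrib)
        also have "\<dots> \<le> (\<integral>x. \<bar>indicator A x * (a x - g m x)\<bar> \<partial>M)" by (rule integral_abs_bound)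
        also have "\<dots> \<le> (\<integral>x. \<bar>a x - g m x\<bar> \<partial>M)"
          using ind[OF int] int ind[OF \<open>integrable M a\<close>] \<open>integrable M a\<close>
          by (intro integral_mono) (auto simp: right_diff_distrib indicator_def split: if_splits)
        also have "\<dots> \<le> e"
        proof -
          have "ennreal (\<integral>x. \<bar>a x - g m x\<bar> \<partial>M) = (\<integral>\<^sup>+x. ennreal \<bar>a x - g m x\<bar> \<partial>M)"
            using int \<open>integrable M a\<close> by (subst nn_integral_eq_integral) auto
          also have "\<dots> \<le> ennreal e" using N by (simp add: m_def)
          finally show ?thesis using that by simp
        qed
        finally show ?thesis .
      qed
      then have "\<bar>(\<integral>x. indicator A x * a x \<partial>M) - (\<integral>x. indicator A x * g n x \<partial>M)\<bar> \<le> 0"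
        by (rule dense_ge)
      then show "(\<integral>x\<in>A. a x \<partial>M) = (\<integral>x\<in>A. g n x \<partial>M)" by (simp add: set_lebesgue_integral_def)
    qed
  qed
  ultimately show thesis by (rule that)
qed

section \<open>Musielak--Orlicz functions and dyadic series\<close>

locale musielak_orlicz_filtration = prob_filtration M F
  for M :: "'a measure" and F :: "nat \<Rightarrow> 'a measure" +
  fixes \<phi> :: "'a \<Rightarrow> real \<Rightarrow> real" and c p :: real
  assumes musielak_orlicz: "musielak_orlicz M \<phi>"
    and integral_finite: "\<And>t. t > 0 \<Longrightarrow> (\<integral>\<^sup>+x. ennreal (\<phi> x t) \<partial>M) < \<infinity>"
    and c_pos: "c > 0" and p_pos: "p > 0"
    and lower_type: "\<And>x t s. x \<in> space M \<Longrightarrow> t \<ge> 0 \<Longrightarrow> 0 < s \<Longrightarrow> s < 1 \<Longrightarrow>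
      \<phi> x (s * t) \<le> c * s powr p * \<phi> x t"
begin

section \<open>Monotonicity and scaling of \<phi>-weighted measures\<close>

lemma phi_measurable [measurable]: "t \<ge> 0 \<Longrightarrow> (\<lambda>x. \<phi> x t) \<in> borel_measurable M"
  using musielak_orlicz by (auto simp: musielak_orlicz_def)

lemma phi_0: "x \<in> space M \<Longrightarrow> \<phi> x 0 = 0"
  using musielak_orlicz by (auto simp: musielak_orlicz_def)

lemma phi_mono: "x \<in> space M \<Longrightarrow> 0 \<le> s \<Longrightarrow> s \<le> t \<Longrightarrow> \<phi> x s \<le> \<phi> x t"
  using musielak_orlicz by (auto simp: musielak_orlicz_def mono_on_def)

lemma phi_nonneg: "x \<in> space M \<Longrightarrow> 0 \<le> t \<Longrightarrow> 0 \<le> \<phi> x t"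
  using phi_mono[of x 0 t] phi_0 by simp

lemma phi_meas_mono:
  assumes "E \<subseteq> E'" "0 \<le> s" "s \<le> t"
  shows "phi_meas M \<phi> E s \<le> phi_meas M \<phi> E' t"
  unfolding phi_meas_def
proof (rule nn_integral_mono)
  fix x assume "x \<in> space M"
  then have "ennreal (\<phi> x s) \<le> ennreal (\<phi> x t)" using phi_mono assms by (intro ennreal_leI) auto
  then show "ennreal (\<phi> x s) * indicator E x \<le> ennreal (\<phi> x t) * indicator E' x"
    using assms(1) by (auto simp: indicator_def)
qed

lemma phi_meas_scale:
  assumes [measurable]: "E \<in> sets M" and "0 < s" "s < 1" "t \<ge> 0"
  shows "phi_meas M \<phi> E (s * t) \<le> ennreal (c * s powr p) * phi_meas M \<phi> E t"
proof -
  have "phi_meas M \<phi> E (s * t) \<le> (\<integral>\<^sup>+x\<in>E. (ennreal (c * s powr p) * ennreal (\<phi> x t)) \<partial>M)"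
    unfolding phi_meas_def
  proof (rule nn_integral_mono)
    fix x assume x: "x \<in> space M"
    have "ennreal (\<phi> x (s * t)) \<le> ennreal (c * s powr p * \<phi> x t)"
      using lower_type[OF x] assms by (intro ennreal_leI) auto
    also have "\<dots> = ennreal (c * s powr p) * ennreal (\<phi> x t)"
      using c_pos phi_nonneg[OF x \<open>t \<ge> 0\<close>] by (intro ennreal_mult) auto
    finally show "ennreal (\<phi> x (s * t)) * indicator E x \<le>
        ennreal (c * s powr p) * ennreal (\<phi> x t) * indicator E x"
      by (intro mult_right_mono) auto
  qed
  also have "\<dots> = ennreal (c * s powr p) * phi_meas M \<phi> E t"
    using assms by (simp add: phi_meas_def mult.assoc nn_integral_cmult)
  finally show ?thesis .
qed

text \<open>\<open>\<phi> x n\<close> grows to infinity at every point, so by monotone convergence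
  the integrals over a set of positive measure could not stay below one.\<close>

lemma null_set_of_phi_meas_bounded:
  assumes E [measurable]: "E \<in> sets M" and bound: "\<And>t. t > 0 \<Longrightarrow> phi_meas M \<phi> E t \<le> 1"
  shows "AE x in M. x \<notin> E"
proof -
  let ?f = "\<lambda>n x. ennreal (\<phi> x (real n)) * indicator E x"
  have "(\<integral>\<^sup>+x. (SUP n. ?f n x) \<partial>M) = (SUP n. \<integral>\<^sup>+x. ?f n x \<partial>M)"
  proof (rule nn_integral_monotone_convergence_SUP_AE)
    show "AE x in M. ?f n x \<le> ?f (Suc n) x" for n
      using phi_mono[of _ "real n" "real (Suc n)"]
      by (intro AE_I2 mult_right_mono ennreal_leI) auto
  qed measurable
  also have "\<dots> \<le> 1"
  proof (rule SUP_least)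
    fix n
    have "phi_meas M \<phi> E (real n) \<le> phi_meas M \<phi> E (real (Suc n))"
      by (intro phi_meas_mono) auto
    also have "\<dots> \<le> 1" by (intro bound) simp
    finally show "(\<integral>\<^sup>+x. ?f n x \<partial>M) \<le> 1" by (simp add: phi_meas_def)
  qed
  finally have "(\<integral>\<^sup>+x. (SUP n. ?f n x) \<partial>M) \<noteq> \<infinity>"
    by (auto simp: top_unique)
  then have "AE x in M. (SUP n. ?f n x) \<noteq> \<infinity>"
    by (intro nn_integral_noteq_infinite) measurable
  then show ?thesis
  proof (rule AE_mp[OF _ AE_I2], intro impI notI)
    fix x assume x: "x \<in> space M" and ne: "(SUP n. ?f n x) \<noteq> \<infinity>" and "x \<in> E"
    have "filterlim (\<phi> x) at_top at_top"
      using musielak_orlicz x by (auto simp: musielak_orlicz_def)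
    then have "filterlim (\<lambda>n. \<phi> x (real n)) at_top sequentially"
      using filterlim_real_sequentially by (rule filterlim_compose)
    then have "\<exists>n. real k \<le> \<phi> x (real n)" for k :: nat
      unfolding filterlim_at_top eventually_sequentially by blast
    then have "\<exists>n. of_nat k \<le> ennreal (\<phi> x (real n))" for k
      unfolding ennreal_of_nat_eq_real_of_nat using ennreal_leI by meson
    then have "(SUP n. ennreal (\<phi> x (real n))) = \<infinity>"
      by (simp add: ennreal_SUP_eq_top)
    with ne \<open>x \<in> E\<close> show False by simp
  qed
qed

section \<open>Norms of indicators\<close>

lemma Lphi_norm_indicator:
  "Lphi_norm M \<phi> (indicator E) = Inf {ereal l |l. l > 0 \<and> phi_meas M \<phi> E (1 / l) \<le> 1}"
proof -
  have "(\<integral>\<^sup>+x. ennreal (\<phi> x (\<bar>indicator E x\<bar> / l)) \<partial>M) = phi_meas M \<phi> E (1 / l)" for l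
    unfolding phi_meas_def by (rule nn_integral_cong) (auto simp: indicator_def phi_0)
  then show ?thesis by (simp add: Lphi_norm_def)
qed

text \<open>By the lower type, dividing the argument by a large \<open>l\<close> shrinks the
  integral by the factor \<open>l powr (- p)\<close> up to a constant, so some \<open>l\<close> is
  admissible.\<close>

lemma Lphi_norm_indicator_finite:
  assumes E: "E \<in> sets M"
  obtains w where "w \<ge> 0" "Lphi_norm M \<phi> (indicator E) = ereal w"
proof -
  have "phi_meas M \<phi> E 1 \<le> (\<integral>\<^sup>+x. ennreal (\<phi> x 1) \<partial>M)"
    unfolding phi_meas_def by (intro nn_integral_mono) (auto simp: indicator_def)
  also have "\<dots> < \<infinity>" by (rule integral_finite) simp
  finally obtain r where r: "r \<ge> 0" "phi_meas M \<phi> E 1 = ennreal r"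
    by (cases "phi_meas M \<phi> E 1") auto
  \<comment> \<open>Chosen so that \<open>l powr p\<close> exceeds \<open>c * r\<close>; the leading
    \<open>1\<close> makes \<open>1 / l\<close> smaller than one, as the lower type
    requires.\<close>
  define l where "l = 1 + (c * r + 1) powr (1 / p)"
  have cr: "c * r \<ge> 0" using c_pos r by simp
  have l: "l > 1" using cr by (simp add: l_def)
  have "c * r \<le> (c * r + 1)" by simp
  also have "\<dots> = ((c * r + 1) powr (1 / p)) powr p"
    using p_pos cr by (simp add: powr_powr)
  also have "\<dots> \<le> l powr p"
    using p_pos by (intro powr_mono2) (auto simp: l_def)
  finally have le: "c * (1 / l) powr p * r \<le> 1"
    using l by (simp add: powr_divide field_simps)
  have "phi_meas M \<phi> E (1 / l * 1) \<le> ennreal (c * (1 / l) powr p) * ennreal r"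
    using phi_meas_scale[OF E, of "1 / l" 1] l r by simp
  also have "\<dots> = ennreal (c * (1 / l) powr p * r)"
    using c_pos r by (simp add: ennreal_mult)
  also have "\<dots> \<le> 1" using le by (simp add: ennreal_le_1)
  finally have "Lphi_norm M \<phi> (indicator E) \<le> ereal l"
    unfolding Lphi_norm_indicator using l by (intro Inf_lower) auto
  moreover have "0 \<le> Lphi_norm M \<phi> (indicator E)"
    unfolding Lphi_norm_indicator by (rule Inf_greatest) auto
  ultimately show thesis
    using that by (cases "Lphi_norm M \<phi> (indicator E)") auto
qed

text \<open>Norm zero means that arbitrarily small \<open>l\<close> are admissible, so the weighted
  measure of \<open>E\<close> is at most one at every argument. This settles the levels whose atom
  coefficient vanishes.\<close>

lemma Lphi_norm_indicator_eq_0: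
  assumes "E \<in> sets M" "Lphi_norm M \<phi> (indicator E) = 0"
  shows "AE x in M. x \<notin> E"
proof (rule null_set_of_phi_meas_bounded[OF assms(1)])
  fix t :: real assume "t > 0"
  then have "Lphi_norm M \<phi> (indicator E) < ereal (1 / t)" using assms(2) by simp
  then obtain l where l: "l > 0" "phi_meas M \<phi> E (1 / l) \<le> 1" "l < 1 / t"
    unfolding Lphi_norm_indicator Inf_less_iff by auto
  then have "t \<le> 1 / l" using \<open>t > 0\<close> by (simp add: field_simps)
  then have "phi_meas M \<phi> E t \<le> phi_meas M \<phi> E (1 / l)"
    using \<open>t > 0\<close> by (intro phi_meas_mono) auto
  with l show "phi_meas M \<phi> E t \<le> 1" by simp
qed

text \<open>For fixed \<open>t\<close> the weighted measure is the measure with density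
  \<open>\<phi> x t\<close>, hence countably subadditive.\<close>

lemma phi_meas_union:
  assumes [measurable]: "\<And>i :: nat. A i \<in> sets M" and "t \<ge> 0"
  shows "phi_meas M \<phi> (\<Union>i. A i) t \<le> (\<Sum>i. phi_meas M \<phi> (A i) t)"
proof -
  have "emeasure (density M (\<lambda>x. ennreal (\<phi> x t))) (\<Union>i. A i) \<le>
      (\<Sum>i. emeasure (density M (\<lambda>x. ennreal (\<phi> x t))) (A i))"
    by (intro emeasure_subadditive_countably) auto
  then show ?thesis
    using \<open>t \<ge> 0\<close> by (simp add: emeasure_density phi_meas_def)
qed

text \<open>The lower type turns the gap between levels \<open>j\<close> and
  \<open>j + int i\<close> into the factor \<open>((1 / 2) powr p) ^ i\<close>, so the union over
  all higher levels costs a convergent geometric series.\<close>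

lemma phi_meas_tail:
  fixes B :: "int \<Rightarrow> 'a set"
  assumes B: "\<And>k. B k \<in> sets M" and l: "l > 0" and K: "K > 1"
    and bound: "\<And>k. phi_meas M \<phi> (B k) (2 powi k / l) \<le> 1"
  shows "phi_meas M \<phi> (\<Union>i. B (j + int i)) (2 powi j / (K * l)) \<le>
    ennreal (c * (1 / K) powr p / (1 - (1 / 2) powr p))"
proof -
  have half: "0 < (1 / 2) powr p" "(1 / 2) powr p < 1"
    using p_pos powr_less_mono2[of p "1/2" 1] by auto
  have "phi_meas M \<phi> (B (j + int i)) (2 powi j / (K * l)) \<le>
      ennreal (c * (1 / K) powr p * ((1 / 2) powr p) ^ i)" for i
  proof -
    \<comment> \<open>\<open>s\<close> is the ratio of the common argument to the admissible
      argument of the set at level \<open>j + int i\<close>; \<open>K > 1\<close> makes it less than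
      one even for \<open>i = 0\<close>.\<close>
    define s where "s = (1 / 2) ^ i / K"
    have s: "0 < s" "s < 1"
    proof -
      have "(1 / 2 :: real) ^ i \<le> 1" by (simp add: power_le_one)
      then show "s < 1" using K by (simp add: s_def del: power_one_over)
      show "0 < s" using K by (simp add: s_def)
    qed
    have "2 powi j / (K * l) = s * (2 powi (j + int i) / l)"
      by (simp add: s_def power_int_add power_divide)
    then have "phi_meas M \<phi> (B (j + int i)) (2 powi j / (K * l)) \<le>
        ennreal (c * s powr p) * phi_meas M \<phi> (B (j + int i)) (2 powi (j + int i) / l)"
      using phi_meas_scale[OF B s, of "2 powi (j + int i) / l"] l by simp
    also have "\<dots> \<le> ennreal (c * s powr p) * 1"
      by (intro mult_left_mono bound) simp
    also have "s powr p = (1 / K) powr p * ((1 / 2) powr p) ^ i"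
      using K by (simp add: s_def powr_divide powr_powr powr_mult power_divide mult.commute flip: powr_realpow)
    finally show ?thesis by (simp add: mult.assoc)
  qed
  then have "phi_meas M \<phi> (\<Union>i. B (j + int i)) (2 powi j / (K * l)) \<le>
      (\<Sum>i. ennreal (c * (1 / K) powr p * ((1 / 2) powr p) ^ i))"
    using l K B by (intro order.trans[OF phi_meas_union] suminf_le) auto
  also have "\<dots> = ennreal (c * (1 / K) powr p / (1 - (1 / 2) powr p))"
  proof (rule suminf_ennreal_eq)
    show "(\<lambda>i. c * (1 / K) powr p * ((1 / 2) powr p) ^ i) sums
        (c * (1 / K) powr p / (1 - (1 / 2) powr p))"
      using sums_mult[OF geometric_sums[of "(1 / 2) powr p"], of "c * (1 / K) powr p"] half by simp
  qed (use c_pos half in auto)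
  finally show ?thesis .
qed

text \<open>Its power \<open>tail_const powr p\<close> dominates
  \<open>c / (1 - (1 / 2) powr p)\<close>, so taking it as \<open>K\<close> brings the tail bound
  down to one; the summand \<open>1\<close> ensures \<open>K > 1\<close>.\<close>

definition tail_const :: real where
  "tail_const = 1 + (c / (1 - (1 / 2) powr p)) powr (1 / p)"

lemma tail_const: "tail_const > 1" "c * (1 / tail_const) powr p / (1 - (1 / 2) powr p) \<le> 1"
proof -
  have half: "(1 / 2) powr p < 1"
    using p_pos powr_less_mono2[of p "1/2" 1] by auto
  define d where "d = c / (1 - (1 / 2) powr p)"
  have d: "d > 0" using half c_pos by (simp add: d_def)
  then show K: "tail_const > 1" by (simp add: tail_const_def flip: d_def)
  have "d = (d powr (1 / p)) powr p" using d p_pos by (simp add: powr_powr)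
  also have "\<dots> \<le> tail_const powr p"
    using p_pos by (intro powr_mono2) (auto simp: tail_const_def d_def)
  finally have "d * (1 / tail_const) powr p \<le> 1"
    using K by (simp add: powr_divide field_simps)
  then show "c * (1 / tail_const) powr p / (1 - (1 / 2) powr p) \<le> 1"
    by (simp add: d_def)
qed

end

text \<open>Symmetric partial sums of nonnegative terms increase to the unordered sum over the
  integers; values in \<open>ennreal\<close> remove any question of convergence.\<close>

definition dyadic_series :: "real \<Rightarrow> (int \<Rightarrow> 'a set) \<Rightarrow> 'a \<Rightarrow> ennreal" where
  "dyadic_series C B x =
     (SUP N. \<Sum>k\<in>{- int N..int N}. ennreal (C * 2 powi k) * indicator (B k) x)"

lemma dyadic_series_measurable [measurable (raw)]:
  assumes [measurable]: "\<And>k. B k \<in> sets N"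
  shows "dyadic_series C B \<in> borel_measurable N"
  unfolding dyadic_series_def by measurable

lemma dyadic_series_mono:
  assumes "\<And>k. B k \<subseteq> B' k"
  shows "dyadic_series C B x \<le> dyadic_series C B' x"
  unfolding dyadic_series_def using assms
  by (intro SUP_mono' sum_mono mult_left_mono) (auto simp: indicator_def)

text \<open>Telescoping, since \<open>2 powi k = 2 powi (k + 1) - 2 powi k\<close>.\<close>

lemma sum_power_int_le:
  fixes j m :: int
  shows "(\<Sum>k\<in>{m..<j}. 2 powi k :: real) \<le> 2 powi j"
proof (cases "m \<le> j")
  case True
  have "(\<Sum>k\<in>{m..<m + int n}. 2 powi k :: real) = 2 powi (m + int n) - 2 powi m" for n
  proof (induction n)
    case (Suc n)
    have "{m..<m + int (Suc n)} = insert (m + int n) {m..<m + int n}" by auto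
    with Suc show ?case by (simp add: power_int_add)
  qed simp
  from this[of "nat (j - m)"] True show ?thesis by simp
qed simp

text \<open>Outside the tail sets only levels below \<open>j\<close> contribute, and their weights
  add up to at most the next dyadic weight, uniformly in the cutoff \<open>N\<close>.\<close>

lemma dyadic_series_le:
  assumes C: "C \<ge> 0" and x: "x \<notin> (\<Union>i. B (j + int i))"
  shows "dyadic_series C B x \<le> ennreal (C * 2 powi j)"
  unfolding dyadic_series_def
proof (rule SUP_least)
  fix N
  have "x \<notin> B k" if "k \<ge> j" for k
    using x UN_I[of "nat (k - j)" UNIV x "\<lambda>i. B (j + int i)"] that by auto
  then have "(\<Sum>k\<in>{- int N..int N}. ennreal (C * 2 powi k) * indicator (B k) x) \<le>
      (\<Sum>k\<in>{- int N..int N}. if k < j then ennreal (C * 2 powi k) else 0)"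
    by (intro sum_mono) (auto simp: indicator_def not_less)
  also have "\<dots> = (\<Sum>k\<in>{- int N..int N} \<inter> {..<j}. ennreal (C * 2 powi k))"
    by (subst sum.inter_restrict) auto
  also have "\<dots> \<le> (\<Sum>k\<in>{- int N..<j}. ennreal (C * 2 powi k))"
    by (intro sum_mono2) auto
  also have "\<dots> = ennreal (C * (\<Sum>k\<in>{- int N..<j}. 2 powi k))"
    using C by (simp add: sum_ennreal sum_distrib_left)
  also have "\<dots> \<le> ennreal (C * 2 powi j)"
    using C by (intro ennreal_leI mult_left_mono sum_power_int_le)
  finally show "(\<Sum>k\<in>{- int N..int N}. ennreal (C * 2 powi k) * indicator (B k) x) \<le> ennreal (C * 2 powi j)" .
qed

text \<open>Finiteness matters because \<open>enn2real\<close> maps infinity to zero.\<close>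

lemma sum_le_dyadic_series:
  assumes C: "C \<ge> 0" and fin: "dyadic_series C B x < \<infinity>"
  shows "(\<Sum>k\<in>{- int N..int N}. C * 2 powi k * indicator (B k) x) \<le> enn2real (dyadic_series C B x)"
proof -
  have "ennreal (\<Sum>k\<in>{- int N..int N}. C * 2 powi k * indicator (B k) x) =
      (\<Sum>k\<in>{- int N..int N}. ennreal (C * 2 powi k) * indicator (B k) x)"
    using C by (subst sum_ennreal[symmetric]) (auto intro!: sum.cong simp: indicator_def)
  also have "\<dots> \<le> dyadic_series C B x"
    unfolding dyadic_series_def by (rule SUP_upper) simp
  finally have "ennreal (\<Sum>k\<in>{- int N..int N}. C * 2 powi k * indicator (B k) x) \<le> dyadic_series C B x" .
  then have "enn2real (ennreal (\<Sum>k\<in>{- int N..int N}. C * 2 powi k * indicator (B k) x)) \<le> enn2real (dyadic_series C B x)"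
    using fin by (intro enn2real_mono) auto
  then show ?thesis using C by (simp add: sum_nonneg)
qed

lemma exists_dyadic_bracket:
  fixes y :: real
  assumes "y > 0"
  obtains j :: int where "2 powi j \<le> y" "y < 2 powi (j + 1)"
proof
  let ?j = "\<lfloor>log 2 y\<rfloor>"
  have "2 powr real_of_int ?j \<le> 2 powr log 2 y" by (intro powr_mono) auto
  then show "2 powi ?j \<le> y" using assms by (simp add: powr_real_of_int')
  have "2 powr log 2 y < 2 powr real_of_int (?j + 1)" by (intro powr_less_mono) linarith+
  then show "y < 2 powi (?j + 1)"
    using assms powr_real_of_int'[of 2 "?j + 1"] by simp
qed

context musielak_orlicz_filtration
begin

text \<open>With \<open>2 powi j\<close> the dyadic number just below \<open>\<alpha> / C\<close>, a
  value above \<open>\<alpha>\<close> forces membership in a set of level at least \<open>j\<close>,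
  so the tail bound applies. The factor 2 pays for rounding \<open>\<alpha> / C\<close> down,
  \<open>tail_const\<close> for the union over levels.\<close>

lemma dyadic_series_weak_estimate:
  assumes B: "\<And>k. B k \<in> sets M" and l: "l > 0" and C: "C > 0"
    and bound: "\<And>k. phi_meas M \<phi> (B k) (2 powi k / l) \<le> 1" and "\<alpha> > 0"
  shows "phi_meas M \<phi> {x \<in> space M. dyadic_series C B x > ennreal \<alpha>}
    (\<alpha> / (2 * C * tail_const * l)) \<le> 1"
proof -
  obtain j where j: "2 powi j \<le> \<alpha> / C" "\<alpha> / C < 2 powi (j + 1)"
    using exists_dyadic_bracket[of "\<alpha> / C"] \<open>\<alpha> > 0\<close> C by auto
  have "phi_meas M \<phi> {x \<in> space M. dyadic_series C B x > ennreal \<alpha>} (\<alpha> / (2 * C * tail_const * l))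
      \<le> phi_meas M \<phi> (\<Union>i. B (j + int i)) (2 powi j / (tail_const * l))"
  proof (rule phi_meas_mono)
    show "{x \<in> space M. dyadic_series C B x > ennreal \<alpha>} \<subseteq> (\<Union>i. B (j + int i))"
    proof (rule subsetI, rule ccontr)
      fix x assume x: "x \<in> {x \<in> space M. dyadic_series C B x > ennreal \<alpha>}" "x \<notin> (\<Union>i. B (j + int i))"
      have "dyadic_series C B x \<le> ennreal (C * 2 powi j)"
        using dyadic_series_le[OF _ x(2)] C by simp
      also have "\<dots> \<le> ennreal \<alpha>" using j(1) C by (intro ennreal_leI) (simp add: field_simps)
      finally show False using x(1) by (simp add: not_le[symmetric])
    qed
    have "\<alpha> \<le> 2 powi j * (2 * C)" using j(2) C by (simp add: power_int_add field_simps)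
    then have "\<alpha> / (2 * C) \<le> 2 powi j" using C by (simp add: field_simps)
    then have "\<alpha> / (2 * C) / (tail_const * l) \<le> 2 powi j / (tail_const * l)"
      using l tail_const(1) by (intro divide_right_mono) auto
    then show "\<alpha> / (2 * C * tail_const * l) \<le> 2 powi j / (tail_const * l)"
      by (simp add: mult.assoc)
  qed (use \<open>\<alpha> > 0\<close> C tail_const(1) l in auto)
  also have "\<dots> \<le> ennreal (c * (1 / tail_const) powr p / (1 - (1 / 2) powr p))"
    by (rule phi_meas_tail[OF B l tail_const(1) bound])
  also have "\<dots> \<le> 1" using tail_const(2) by (simp add: ennreal_le_1)
  finally show ?thesis .
qed

lemma dyadic_series_finite:
  assumes B: "\<And>k. B k \<in> sets M" and l: "l > 0" and C: "C > 0"
    and bound: "\<And>k. phi_meas M \<phi> (B k) (2 powi k / l) \<le> 1"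
  shows "AE x in M. dyadic_series C B x < \<infinity>"
proof -
  note [measurable] = B
  have "AE x in M. x \<notin> {x \<in> space M. dyadic_series C B x = \<infinity>}"
  proof (rule null_set_of_phi_meas_bounded)
    fix t :: real assume "t > 0"
    \<comment> \<open>Chosen so that the weak estimate is evaluated at the argument
      \<open>t\<close>; a point where the series is infinite lies in every superlevel set.\<close>
    define \<alpha> where "\<alpha> = t * (2 * C * tail_const * l)"
    have "\<alpha> > 0" using \<open>t > 0\<close> C tail_const(1) l by (simp add: \<alpha>_def)
    have t: "t = \<alpha> / (2 * C * tail_const * l)" using C tail_const(1) l by (simp add: \<alpha>_def)
    have "phi_meas M \<phi> {x \<in> space M. dyadic_series C B x = \<infinity>} t \<le>
        phi_meas M \<phi> {x \<in> space M. dyadic_series C B x > ennreal \<alpha>} (\<alpha> / (2 * C * tail_const * l))"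
      using \<open>t > 0\<close> t by (intro phi_meas_mono) auto
    also have "\<dots> \<le> 1" by (rule dyadic_series_weak_estimate) fact+
    finally show "phi_meas M \<phi> {x \<in> space M. dyadic_series C B x = \<infinity>} t \<le> 1" .
  qed measurable
  then show ?thesis by (rule AE_mp[OF _ AE_I2]) (auto simp: less_top)
qed

end

section \<open>From atomic decompositions to majorants\<close>

text \<open>The common features of the pairs \<open>(M(g), \<bar>g n\<bar>)\<close> and \<open>(S(g), S\<^sub>n(g))\<close>.\<close>

locale size_operator = prob_filtration M F
  for M :: "'a measure" and F :: "nat \<Rightarrow> 'a measure" +
  fixes T :: "(nat \<Rightarrow> 'a \<Rightarrow> real) \<Rightarrow> 'a \<Rightarrow> ereal"
    and U :: "(nat \<Rightarrow> 'a \<Rightarrow> real) \<Rightarrow> nat \<Rightarrow> 'a \<Rightarrow> real"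
  assumes T_eq_SUP: "T g x = (SUP n. ereal (U g n x))"
    and U_nonneg: "0 \<le> U g n x"
    and U_scale: "U (\<lambda>i x. r * g i x) n x = \<bar>r\<bar> * U g n x"
    and U_triangle: "U (\<lambda>i x. g i x + h i x) n x \<le> U g n x + U h n x"
    and U_tendsto: "(\<And>i. i \<le> n \<Longrightarrow> (\<lambda>N. G N i x) \<longlonglongrightarrow> g i x) \<Longrightarrow> (\<lambda>N. U (G N) n x) \<longlonglongrightarrow> U g n x"
    and U_measurable: "(\<And>i. g i \<in> borel_measurable M) \<Longrightarrow> U g n \<in> borel_measurable M"
    and U_transform: "f 0 x = 0 \<Longrightarrow> incseq (\<lambda>n. l n x) \<Longrightarrow>
      (\<And>n. n \<ge> 1 \<Longrightarrow> U f n x \<le> l (n - 1) x) \<Longrightarrow> \<theta> \<ge> 0 \<Longrightarrow>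
      U (martingale_transform (\<lambda>i y. indicator {\<theta><..2 * \<theta>} (l i y)) f) n x \<le> 3 * \<theta>"
    and U_increment: "U f n x = 0 \<Longrightarrow> U f (Suc n) x = 0 \<Longrightarrow> f (Suc n) x = f n x"
    and U_L2: "g \<in> martingales0 M F \<Longrightarrow> AE x in M. \<forall>n. U g n x \<le> K \<Longrightarrow>
      integrable M (\<lambda>x. (g n x)\<^sup>2) \<and> (\<integral>x. (g n x)\<^sup>2 \<partial>M) \<le> K\<^sup>2"
begin

text \<open>\<open>U_tendsto\<close> for a constant sequence shows that \<open>U g n x\<close>
  depends only on the values at \<open>x\<close> up to time \<open>n\<close>: both sides are limits
  of the same sequence.\<close>

lemma U_cong:
  assumes "\<And>i. i \<le> n \<Longrightarrow> g i x = h i x"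
  shows "U g n x = U h n x"
proof (rule LIMSEQ_unique)
  show "(\<lambda>N. U g n x) \<longlonglongrightarrow> U g n x" by simp
  show "(\<lambda>N. U g n x) \<longlonglongrightarrow> U h n x"
    using assms by (intro U_tendsto) auto
qed

lemma U_eq_0: "(\<And>i. i \<le> n \<Longrightarrow> g i x = 0) \<Longrightarrow> U g n x = 0"
  using U_cong[of n g x "\<lambda>i x. 0 * g i x"] U_scale[of 0 g n x] by simp

lemma U_sum:
  assumes "finite I"
  shows "U (\<lambda>i x. \<Sum>k\<in>I. r k * g k i x) n x \<le> (\<Sum>k\<in>I. \<bar>r k\<bar> * U (g k) n x)"
  using assms
proof (induction I)
  case empty
  then show ?case by (simp add: U_eq_0)
next
  case (insert k I)
  have "U (\<lambda>i x. \<Sum>k\<in>insert k I. r k * g k i x) n x \<le>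
      U (\<lambda>i x. r k * g k i x) n x + U (\<lambda>i x. \<Sum>k\<in>I. r k * g k i x) n x"
    using insert.hyps U_triangle[of "\<lambda>i x. r k * g k i x"] by simp
  with insert show ?case by (simp add: U_scale)
qed

lemma T_measurable:
  assumes "\<And>i. g i \<in> borel_measurable M"
  shows "T g \<in> borel_measurable M"
proof -
  note [measurable] = U_measurable[of g, OF assms]
  show ?thesis by (subst T_eq_SUP[abs_def]) measurable
qed

lemma T_nonneg: "0 \<le> T g x"
  unfolding T_eq_SUP using U_nonneg by (intro SUP_upper2[of 0]) auto

text \<open>The common form of \<open>Lambda_WP\<close> and \<open>Lambda_WQ\<close>, which arise
  from the two choices of \<open>U\<close>.\<close>

definition majorants :: "('a \<Rightarrow> real \<Rightarrow> real) \<Rightarrow> (nat \<Rightarrow> 'a \<Rightarrow> real) \<Rightarrow> (nat \<Rightarrow> 'a \<Rightarrow> real) set" where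
  "majorants \<phi> f = {l \<in> Lambda_seqs M F.
     (\<forall>n\<ge>1. AE x in M. U f n x \<le> l (n - 1) x) \<and> seq_limit l \<in> WL M \<phi>}"

end

text \<open>The symmetric intervals eventually contain any finite set of integers, so they run along
  the filter that defines the unconditional sum.\<close>

lemma tendsto_of_has_sum_int:
  fixes f :: "int \<Rightarrow> 'b :: {comm_monoid_add, topological_space}"
  assumes "(f has_sum s) UNIV"
  shows "(\<lambda>N. \<Sum>k\<in>{- int N..int N}. f k) \<longlonglongrightarrow> s"
proof -
  have "filterlim (\<lambda>N. {- int N..int N}) (finite_subsets_at_top UNIV) sequentially"
    unfolding filterlim_finite_subsets_at_top
  proof (intro allI impI)
    fix X :: "int set" assume "finite X \<and> X \<subseteq> UNIV"
    then obtain b where b: "\<And>k. k \<in> X \<Longrightarrow> \<bar>k\<bar> \<le> b"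
      using bdd_above_finite[of "abs ` X"] by (auto simp: bdd_above_def)
    show "\<forall>\<^sub>F N in sequentially. finite {- int N..int N} \<and> X \<subseteq> {- int N..int N} \<and> {- int N..int N} \<subseteq> UNIV"
      using eventually_ge_at_top[of "nat b"]
    proof eventually_elim
      case (elim N)
      then show ?case using b by force
    qed
  qed
  with assms show ?thesis
    unfolding has_sum_def by (rule filterlim_compose)
qed

lemma less_infinity_iff_enat_bound: "(m :: enat) < \<infinity> \<longleftrightarrow> (\<exists>n. m \<le> enat n)"
  by (cases m) auto

lemma seq_limit_eq_SUP:
  "incseq (\<lambda>n. l n x) \<Longrightarrow> seq_limit l x = (SUP n. ereal (l n x))"
  unfolding seq_limit_def by (intro limI LIMSEQ_SUP) (auto simp: incseq_def)

locale atomic_setting =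
  musielak_orlicz_filtration M F \<phi> c p + size_operator M F T U
  for M :: "'a measure" and F :: "nat \<Rightarrow> 'a measure" and \<phi> and c p :: real and T U +
  fixes C :: real
  assumes C_pos: "C > 0"
begin

lemma B_set_sets:
  assumes "ext_stopping_time M F \<nu>"
  shows "B_set M \<nu> \<in> sets M"
proof -
  have "B_set M \<nu> = (\<Union>n. {x \<in> space M. \<nu> x \<le> enat n})"
    unfolding B_set_def less_infinity_iff_enat_bound by auto
  also have "\<dots> \<in> sets M"
    using sets_F_M[OF assms[unfolded ext_stopping_time_def, rule_format]] by blast
  finally show ?thesis .
qed

text \<open>Up to time \<open>\<nu> x\<close> the martingale of the atom vanishes; afterwards the
  size condition cancels the norm. The strict inequality \<open>\<nu> x < enat n\<close> is what
  makes the resulting majorant predictable.\<close>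

lemma atom_U_bound:
  assumes a: "atom T M F \<phi> a \<nu>"
  shows "AE x in M. \<forall>n. real_of_ereal (Lphi_norm M \<phi> (indicator (B_set M \<nu>))) * U (cond_mart M F a) n x
    \<le> (if \<nu> x < enat n then 1 else 0)"
proof -
  from a have "B_set M \<nu> \<in> sets M" by (intro B_set_sets) (simp add: atom_def)
  then obtain w where w: "w \<ge> 0" "Lphi_norm M \<phi> (indicator (B_set M \<nu>)) = ereal w"
    by (rule Lphi_norm_indicator_finite)
  have "AE x in M. \<forall>n. enat n \<le> \<nu> x \<longrightarrow> cond_mart M F a n x = 0"
    using a by (simp add: AE_all_countable atom_def)
  moreover have "AE x in M. \<bar>T (cond_mart M F a) x\<bar> \<le> Linf_norm M (T (cond_mart M F a))"
    unfolding Linf_norm_def by (rule esssup_AE)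
  ultimately show ?thesis
  proof eventually_elim
    case (elim x)
    show ?case
    proof
      fix n
      show "real_of_ereal (Lphi_norm M \<phi> (indicator (B_set M \<nu>))) * U (cond_mart M F a) n x
          \<le> (if \<nu> x < enat n then 1 else 0)"
      proof (cases "\<nu> x < enat n")
        case False
        then have "cond_mart M F a i x = 0" if "i \<le> n" for i
          using elim(1) that by (meson enat_ord_simps(1) not_le order.trans)
        then show ?thesis using False by (simp add: U_eq_0)
      next
        case True
        \<comment> \<open>For \<open>w = 0\<close> the size condition gives no bound, as
          \<open>inverse 0\<close> is infinite, but the left side is then zero.\<close>
        show ?thesis
        proof (cases "w = 0")
          case False
          have "ereal (U (cond_mart M F a) n x) \<le> T (cond_mart M F a) x"
            unfolding T_eq_SUP by (rule SUP_upper) simp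
          also have "\<dots> \<le> inverse (ereal w)"
            using elim(2) a T_nonneg[of "cond_mart M F a" x] w by (auto simp: atom_def)
          finally show ?thesis using False w True by (simp add: field_simps)
        qed (use w True in simp)
      qed
    qed
  qed
qed

text \<open>The limit of the constructed majorant is at most the dyadic series over the full sets
  \<open>B_set M (\<nu> k)\<close>, so the weak estimate for that series bounds its
  quasi-norm.\<close>

lemma majorant_of_decomposition:
  assumes dec: "atomic_decomp T M F \<phi> C f a \<nu>" and r: "r > 0"
    and bound: "(SUP k. phi_meas M \<phi> (B_set M (\<nu> k)) (2 powi k / r)) \<le> 1"
  obtains l where "l \<in> majorants \<phi> f" "WL_norm M \<phi> (seq_limit l) \<le> ereal (2 * C * tail_const * r)"
proof -
  have st: "ext_stopping_time M F (\<nu> k)" and at: "atom T M F \<phi> (a k) (\<nu> k)" for k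
    using dec by (auto simp: atomic_decomp_def atom_def)
  define A where "A n k = {x \<in> space M. \<nu> k x \<le> enat n}" for n k
  have A: "A n k \<in> sets (F n)" for n k
    using st by (simp add: A_def ext_stopping_time_def)
  define B where "B k = B_set M (\<nu> k)" for k
  have B: "B k \<in> sets M" for k unfolding B_def by (rule B_set_sets[OF st])
  have AB: "A n k \<subseteq> B k" for n k
    by (auto simp: A_def B_def B_set_def less_infinity_iff_enat_bound simp del: enat_ord_simps)
  have bound': "phi_meas M \<phi> (B k) (2 powi k / r) \<le> 1" for k
    using bound by (simp add: SUP_le_iff B_def)
  \<comment> \<open>The series may be infinite on a null set, where \<open>enn2real\<close> gives \<open>0\<close>; the maximum
    over the past keeps \<open>l\<close> monotone there.\<close>
  define l where "l n x = Max ((\<lambda>m. enn2real (dyadic_series C (A m) x)) ` {..n})" for n x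
  have l_ge: "enn2real (dyadic_series C (A n) x) \<le> l n x" for n x
    unfolding l_def by (intro Max_ge) auto
  have l_le: "ennreal (l n x) \<le> dyadic_series C B x" for n x
  proof -
    have "l n x \<in> (\<lambda>m. enn2real (dyadic_series C (A m) x)) ` {..n}"
      unfolding l_def by (intro Max_in) auto
    then obtain m where "l n x = enn2real (dyadic_series C (A m) x)" by blast
    then have "ennreal (l n x) \<le> dyadic_series C (A m) x"
      by (cases "dyadic_series C (A m) x") auto
    also have "\<dots> \<le> dyadic_series C B x" by (rule dyadic_series_mono[OF AB])
    finally show ?thesis .
  qed
  have l_nonneg: "0 \<le> l n x" for n x
    using l_ge[of n x] order.trans[OF enn2real_nonneg] by blast
  have l_inc: "incseq (\<lambda>n. l n x)" for x
    unfolding l_def by (intro monoI Max_mono) auto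
  have l_meas: "l n \<in> borel_measurable (F n)" for n
    unfolding l_def
  proof (rule borel_measurable_Max)
    fix m assume "m \<in> {..n}"
    have "dyadic_series C (A m) \<in> borel_measurable (F m)"
      by (rule dyadic_series_measurable[OF A])
    then have "(\<lambda>x. enn2real (dyadic_series C (A m) x)) \<in> borel_measurable (F m)" by measurable
    with \<open>m \<in> {..n}\<close> show "(\<lambda>x. enn2real (dyadic_series C (A m) x)) \<in> borel_measurable (F n)"
      by (intro measurable_F_mono[of m n]) auto
  qed simp
  have Lambda: "l \<in> Lambda_seqs M F"
    using l_meas l_nonneg l_inc by (simp add: Lambda_seqs_def)
  have norm: "WL_norm M \<phi> (seq_limit l) \<le> ereal (2 * C * tail_const * r)"
    unfolding WL_norm_def
  proof (intro Inf_lower CollectI exI conjI SUP_least refl)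
    show "2 * C * tail_const * r > 0" using C_pos r tail_const(1) by simp
    fix \<alpha> :: real assume "\<alpha> \<in> {0<..}"
    then have "\<alpha> > 0" by simp
    have sub: "{x \<in> space M. \<bar>seq_limit l x\<bar> > ereal \<alpha>} \<subseteq> {x \<in> space M. dyadic_series C B x > ennreal \<alpha>}"
    proof safe
      fix x assume "ereal \<alpha> < \<bar>seq_limit l x\<bar>"
      moreover have "0 \<le> seq_limit l x"
        unfolding seq_limit_eq_SUP[of l, OF l_inc] using l_nonneg by (intro SUP_upper2[of 0]) auto
      ultimately obtain n where "\<alpha> < l n x"
        unfolding seq_limit_eq_SUP[of l, OF l_inc] by (auto simp: less_SUP_iff)
      then have "ennreal \<alpha> < ennreal (l n x)" using \<open>\<alpha> > 0\<close> by (intro ennreal_lessI) auto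
      with l_le[of n x] show "ennreal \<alpha> < dyadic_series C B x" by (rule less_le_trans[rotated])
    qed
    have "phi_meas M \<phi> {x \<in> space M. \<bar>seq_limit l x\<bar> > ereal \<alpha>} (\<alpha> / (2 * C * tail_const * r)) \<le>
        phi_meas M \<phi> {x \<in> space M. dyadic_series C B x > ennreal \<alpha>} (\<alpha> / (2 * C * tail_const * r))"
      using \<open>\<alpha> > 0\<close> C_pos r tail_const(1) by (intro phi_meas_mono sub) auto
    also have "\<dots> \<le> 1"
      by (rule dyadic_series_weak_estimate[OF B r C_pos bound' \<open>\<alpha> > 0\<close>])
    finally show "phi_meas M \<phi> {x \<in> space M. \<bar>seq_limit l x\<bar> > ereal \<alpha>} (\<alpha> / (2 * C * tail_const * r)) \<le> 1" .
  qed simp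
  have WL: "seq_limit l \<in> WL M \<phi>"
  proof -
    have "seq_limit l \<in> borel_measurable M"
      using measurable_F_M[OF l_meas] unfolding seq_limit_def[abs_def] by measurable
    moreover have "WL_norm M \<phi> (seq_limit l) < \<infinity>"
      using norm by (rule le_less_trans) simp
    ultimately show ?thesis by (simp add: WL_def)
  qed
  have major: "AE x in M. U f n x \<le> l (n - 1) x" if "n \<ge> 1" for n
  proof -
    define q where "q k = real_of_ereal (Lphi_norm M \<phi> (indicator (B_set M (\<nu> k))))" for k
    have q: "q k \<ge> 0" for k
    proof -
      obtain w where "w \<ge> 0" "Lphi_norm M \<phi> (indicator (B_set M (\<nu> k))) = ereal w"
        using Lphi_norm_indicator_finite[OF B_set_sets[OF st]] .
      then show ?thesis by (simp add: q_def)
    qed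
    have "AE x in M. \<forall>i. ((\<lambda>k. atom_coeff M \<phi> C \<nu> k * cond_mart M F (a k) i x) has_sum f i x) UNIV"
      using dec by (simp add: AE_all_countable atomic_decomp_def)
    moreover have "AE x in M. \<forall>k n. q k * U (cond_mart M F (a k)) n x \<le> (if \<nu> k x < enat n then 1 else 0)"
      using atom_U_bound[OF at] by (subst AE_all_countable) (simp add: q_def)
    moreover have "AE x in M. dyadic_series C B x < \<infinity>"
      by (rule dyadic_series_finite[OF B r C_pos bound'])
    ultimately show ?thesis
    proof (rule AE_mp[OF _ AE_mp[OF _ AE_mp[OF _ AE_I2]]], intro impI)
      fix x
      assume x: "x \<in> space M"
        and sums: "\<forall>i. ((\<lambda>k. atom_coeff M \<phi> C \<nu> k * cond_mart M F (a k) i x) has_sum f i x) UNIV"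
        and atoms: "\<forall>k n. q k * U (cond_mart M F (a k)) n x \<le> (if \<nu> k x < enat n then 1 else 0)"
        and fin: "dyadic_series C B x < \<infinity>"
      \<comment> \<open>\<open>U_sum\<close> covers finite sums only, so the bound is proved for
        symmetric partial sums and carried to \<open>f\<close> by \<open>U_tendsto\<close>.\<close>
      define G where "G N i y = (\<Sum>k\<in>{- int N..int N}. atom_coeff M \<phi> C \<nu> k * cond_mart M F (a k) i y)" for N i y
      have "U (G N) n x \<le> l (n - 1) x" for N
      proof -
        have "U (G N) n x \<le> (\<Sum>k\<in>{- int N..int N}. \<bar>atom_coeff M \<phi> C \<nu> k\<bar> * U (cond_mart M F (a k)) n x)"
          unfolding G_def by (intro U_sum) simp
        also have "\<dots> \<le> (\<Sum>k\<in>{- int N..int N}. C * 2 powi k * indicator (A (n - 1) k) x)"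
        proof (rule sum_mono)
          fix k
          \<comment> \<open>For \<open>n \<ge> 1\<close> the event \<open>\<nu> k x < n\<close> is
            \<open>\<nu> k x \<le> n - 1\<close>, already known at time \<open>n - 1\<close>; hence
            the index shift of the majorant.\<close>
          have "\<nu> k x < enat n \<longleftrightarrow> x \<in> A (n - 1) k"
          proof (cases "\<nu> k x")
            case (enat m)
            then show ?thesis using x \<open>n \<ge> 1\<close> by (auto simp: A_def)
          qed (use x in \<open>simp add: A_def\<close>)
          then have "q k * U (cond_mart M F (a k)) n x \<le> indicator (A (n - 1) k) x"
            using atoms[rule_format, of k n] by (simp add: indicator_def split: if_splits)
          then have "C * 2 powi k * (q k * U (cond_mart M F (a k)) n x) \<le> C * 2 powi k * indicator (A (n - 1) k) x"
            using C_pos by (intro mult_left_mono) auto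
          then show "\<bar>atom_coeff M \<phi> C \<nu> k\<bar> * U (cond_mart M F (a k)) n x \<le> C * 2 powi k * indicator (A (n - 1) k) x"
            using C_pos q[of k] by (simp add: atom_coeff_def abs_mult mult.assoc flip: q_def)
        qed
        also have "\<dots> \<le> enn2real (dyadic_series C (A (n - 1)) x)"
          using C_pos le_less_trans[OF dyadic_series_mono[OF AB] fin]
          by (intro sum_le_dyadic_series) auto
        also have "\<dots> \<le> l (n - 1) x" by (rule l_ge)
        finally show ?thesis .
      qed
      moreover have "(\<lambda>N. U (G N) n x) \<longlonglongrightarrow> U f n x"
        unfolding G_def using sums by (intro U_tendsto tendsto_of_has_sum_int) auto
      ultimately show "U f n x \<le> l (n - 1) x"
        by (intro LIMSEQ_le_const2) auto
    qed
  qed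
  from Lambda major WL have "l \<in> majorants \<phi> f" by (simp add: majorants_def)
  then show thesis using norm by (rule that)
qed

end

section \<open>From majorants to atomic decompositions\<close>

text \<open>Half-open dyadic intervals tile the positive half-line; this makes exactly one slice
  active wherever the majorant is positive.\<close>

lemma exists_unique_dyadic_level:
  fixes d y :: real
  assumes "d > 0" "y > 0"
  shows "\<exists>!k :: int. d * 2 powi k < y \<and> y \<le> 2 * (d * 2 powi k)"
proof -
  \<comment> \<open>Bracketing \<open>d / y\<close> rather than \<open>y / d\<close> produces
    intervals closed on the right; the level is then \<open>- j - 1\<close>.\<close>
  obtain j where j: "2 powi j \<le> d / y" "d / y < 2 powi (j + 1)"
    using exists_dyadic_bracket[of "d / y"] assms by auto
  have "d * 2 powi (- j - 1) < y \<and> y \<le> 2 * (d * 2 powi (- j - 1))"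
    using j assms by (simp add: power_int_diff power_int_minus power_int_add field_simps)
  moreover have "k = k'" if k: "d * 2 powi k < y" "y \<le> 2 * (d * 2 powi k)"
    and k': "d * 2 powi k' < y" "y \<le> 2 * (d * 2 powi k')" for k k' :: int
  proof -
    have less: "m \<le> n" if "d * 2 powi m < 2 * (d * 2 powi n)" for m n :: int
    proof -
      have "2 powi m < (2 :: real) powi (n + 1)"
        using that \<open>d > 0\<close> by (simp add: power_int_add mult.left_commute)
      then have "m < n + 1" using power_int_increasing[of "n + 1" m "2 :: real"] by (meson not_le one_le_numeral)
      then show ?thesis by simp
    qed
    show ?thesis using less[of k k'] less[of k' k] k k' by linarith
  qed
  ultimately show ?thesis by blast
qed

context atomic_setting
begin

text \<open>The stopping times are first exceedance times of \<open>l\<close>, so their finiteness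
  sets are superlevel sets of its limit. The second conclusion transfers every admissible
  \<open>r\<close>, which is what comparing the two infima requires.\<close>

lemma decomposition_of_majorant:
  assumes f: "f \<in> martingales0 M F" and l: "l \<in> majorants \<phi> f"
  obtains a \<nu> where "atomic_decomp T M F \<phi> C f a \<nu>"
    "\<And>r. r > 0 \<Longrightarrow> (SUP \<alpha>\<in>{0<..}. phi_meas M \<phi> {x \<in> space M. \<bar>seq_limit l x\<bar> > ereal \<alpha>} (\<alpha> / r)) \<le> 1 \<Longrightarrow>
      (SUP k. phi_meas M \<phi> (B_set M (\<nu> k)) (2 powi k / (r / (C / 3)))) \<le> 1"
proof -
  have l_meas: "l n \<in> borel_measurable (F n)" for n
    using l by (auto simp: majorants_def Lambda_seqs_def)
  have l_nonneg: "0 \<le> l n x" and l_inc: "incseq (\<lambda>n. l n x)" if "x \<in> space M" for n x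
    using l that by (auto simp: majorants_def Lambda_seqs_def)
  have major: "AE x in M. \<forall>n\<ge>1. U f n x \<le> l (n - 1) x"
    using l by (simp add: majorants_def AE_all_countable)
  define \<theta> where "\<theta> k = C / 3 * 2 powi k" for k :: int
  have \<theta>: "\<theta> k > 0" for k using C_pos by (simp add: \<theta>_def)
  define w :: "int \<Rightarrow> nat \<Rightarrow> 'a \<Rightarrow> real" where "w k i x = indicator {\<theta> k<..2 * \<theta> k} (l i x)" for k i x
  define g where "g k = martingale_transform (w k) f" for k
  \<comment> \<open>Weight \<open>i\<close> acts on the increment from \<open>i\<close> to
    \<open>i + 1\<close>, so the slice \<open>g k\<close> still vanishes at the time
    \<open>\<nu> k\<close> itself, as the atom condition on \<open>n \<le> \<nu>\<close>
    demands.\<close>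
  define \<nu> where "\<nu> k x = (if \<exists>n. \<theta> k < l n x then enat (LEAST n. \<theta> k < l n x) else \<infinity>)" for k x
  have \<nu>_le: "\<nu> k x \<le> enat n \<longleftrightarrow> \<theta> k < l n x" if x: "x \<in> space M" for k n x
  proof
    assume "\<nu> k x \<le> enat n"
    then have ex: "\<exists>n. \<theta> k < l n x" and "(LEAST n. \<theta> k < l n x) \<le> n"
      by (auto simp: \<nu>_def split: if_splits)
    with LeastI_ex[OF ex] incseqD[OF l_inc[OF x]] show "\<theta> k < l n x"
      by (meson less_le_trans)
  next
    assume "\<theta> k < l n x"
    then show "\<nu> k x \<le> enat n" by (auto simp: \<nu>_def intro: Least_le)
  qed
  have st: "ext_stopping_time M F (\<nu> k)" for k
    unfolding ext_stopping_time_def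
  proof
    fix n
    have "{x \<in> space M. \<nu> k x \<le> enat n} = {x \<in> space (F n). \<theta> k < l n x}"
      using \<nu>_le by (auto simp: space_F)
    also have "\<dots> \<in> sets (F n)" using l_meas[of n] by measurable
    finally show "{x \<in> space M. \<nu> k x \<le> enat n} \<in> sets (F n)" .
  qed
  have B_eq: "B_set M (\<nu> k) = {x \<in> space M. \<exists>n. \<theta> k < l n x}" for k
    unfolding B_set_def less_infinity_iff_enat_bound using \<nu>_le by auto
  have g_mart: "g k \<in> martingales0 M F" for k
    unfolding g_def
  proof (rule martingale_transform_martingale[OF f])
    show "w k n \<in> borel_measurable (F n)" for n
      using l_meas[of n] unfolding w_def by measurable
  qed (simp add: w_def indicator_def)
  have g_bound: "AE x in M. \<forall>k n. U (g k) n x \<le> 3 * \<theta> k"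
    using major martingaleD(5)[OF f]
  proof (rule AE_mp[OF _ AE_mp[OF _ AE_I2]], intro impI allI)
    fix x k n
    assume "x \<in> space M" "\<forall>n\<ge>1. U f n x \<le> l (n - 1) x" "f 0 x = 0"
    then show "U (g k) n x \<le> 3 * \<theta> k"
      unfolding g_def w_def using \<theta>[of k] by (intro U_transform l_inc) auto
  qed
  have g_0: "g k n x = 0" if "x \<in> space M" "enat n \<le> \<nu> k x" for k n x
  proof -
    have "\<not> \<theta> k < l i x" if "i < n" for i
      using \<nu>_le[OF \<open>x \<in> space M\<close>, of k i] \<open>enat n \<le> \<nu> k x\<close> that
      by (metis enat_ord_simps(2) leD less_le_trans)
    then show ?thesis
      unfolding g_def martingale_transform_def by (intro sum.neutral) (auto simp: w_def indicator_def)
  qed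
  have "\<exists>a. integrable M a \<and> (\<forall>n. AE x in M. real_cond_exp M (F n) a x = g k n x)" for k
  proof -
    have "AE x in M. \<forall>n. U (g k) n x \<le> 3 * \<theta> k" using g_bound by auto
    then have "integrable M (\<lambda>x. (g k n x)\<^sup>2)" "(\<integral>x. (g k n x)\<^sup>2 \<partial>M) \<le> (3 * \<theta> k)\<^sup>2" for n
      using U_L2[OF g_mart] by blast+
    then show ?thesis using L2_bounded_martingale_closed[OF g_mart] by metis
  qed
  then obtain b where b: "integrable M (b k)" "AE x in M. real_cond_exp M (F n) (b k) x = g k n x" for k n
    by metis
  define \<mu> where "\<mu> = atom_coeff M \<phi> C \<nu>"
  \<comment> \<open>If \<open>\<mu> k = 0\<close>, then \<open>a k = 0\<close> by the convention for division; the slice \<open>g k\<close> then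
    vanishes almost everywhere as well.\<close>
  define a where "a k x = b k x / \<mu> k" for k x
  define q where "q k = real_of_ereal (Lphi_norm M \<phi> (indicator (B_set M (\<nu> k))))" for k
  have q: "Lphi_norm M \<phi> (indicator (B_set M (\<nu> k))) = ereal (q k)" "q k \<ge> 0" for k
  proof -
    obtain w where "w \<ge> 0" "Lphi_norm M \<phi> (indicator (B_set M (\<nu> k))) = ereal w"
      using Lphi_norm_indicator_finite[OF B_set_sets[OF st]] .
    then show "Lphi_norm M \<phi> (indicator (B_set M (\<nu> k))) = ereal (q k)" "q k \<ge> 0"
      by (auto simp: q_def)
  qed
  \<comment> \<open>Dividing a slice of size at most \<open>3 * \<theta> k\<close> by this
    coefficient leaves exactly the bound \<open>inverse (q k)\<close> demanded of an atom.\<close>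
  have \<mu>: "\<mu> k = 3 * \<theta> k * q k" for k by (simp add: \<mu>_def atom_coeff_def \<theta>_def q_def)
  have cond_a: "AE x in M. \<forall>k n. cond_mart M F (a k) n x = g k n x / \<mu> k"
    unfolding AE_all_countable
  proof (intro allI)
    fix k n
    interpret sigma_finite_subalgebra M "F n" by (rule cond_exp_locale)
    show "AE x in M. cond_mart M F (a k) n x = g k n x / \<mu> k"
      using real_cond_exp_cdiv[OF b(1), of k "\<mu> k"] b(2)[of n k]
      by eventually_elim (simp add: cond_mart_def a_def[abs_def])
  qed
  have atom: "atom T M F \<phi> (a k) (\<nu> k)" for k
    unfolding atom_def
  proof (intro conjI allI st)
    show "integrable M (a k)" unfolding a_def using b(1) by simp
    show "AE x in M. enat n \<le> \<nu> k x \<longrightarrow> cond_mart M F (a k) n x = 0" for n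
      using cond_a by (rule AE_mp[OF _ AE_I2]) (auto simp: g_0)
    show "Linf_norm M (T (cond_mart M F (a k))) \<le> inverse (Lphi_norm M \<phi> (indicator (B_set M (\<nu> k))))"
    proof (cases "q k = 0")
      case False
      have "T (cond_mart M F (a k)) \<in> borel_measurable M"
        unfolding cond_mart_def by (intro T_measurable) simp
      moreover have "AE x in M. \<bar>T (cond_mart M F (a k)) x\<bar> \<le> inverse (ereal (q k))"
        using cond_a g_bound
      proof eventually_elim
        case (elim x)
        have "T (cond_mart M F (a k)) x \<le> inverse (ereal (q k))"
          unfolding T_eq_SUP
        proof (rule SUP_least)
          fix n
          have "U (cond_mart M F (a k)) n x = U (\<lambda>i x. inverse (\<mu> k) * g k i x) n x"
            using elim(1) by (intro U_cong) (simp add: field_simps)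
          also have "\<dots> = inverse (\<mu> k) * U (g k) n x"
            unfolding U_scale using \<theta>[of k] q(2)[of k] by (simp add: \<mu>)
          also have "\<dots> \<le> inverse (\<mu> k) * (3 * \<theta> k)"
            using elim(2) \<theta>[of k] q(2)[of k] by (intro mult_left_mono) (auto simp: \<mu>)
          also have "\<dots> = inverse (q k)" using \<theta>[of k] by (simp add: \<mu>)
          finally show "ereal (U (cond_mart M F (a k)) n x) \<le> inverse (ereal (q k))"
            using False by simp
        qed
        then show ?case using T_nonneg[of "cond_mart M F (a k)" x] by simp
      qed
      ultimately show ?thesis
        unfolding Linf_norm_def q(1) by (intro esssup_I) auto
    qed (simp add: q)
  qed
  \<comment> \<open>For \<open>q k = 0\<close> the set \<open>B_set M (\<nu> k)\<close> is null, so
    almost everywhere the slice never starts and both sides are zero.\<close>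
  have "AE x in M. \<forall>k n. \<mu> k * cond_mart M F (a k) n x = g k n x"
  proof -
    have "AE x in M. q k = 0 \<longrightarrow> x \<notin> B_set M (\<nu> k)" for k
      using Lphi_norm_indicator_eq_0[OF B_set_sets[OF st[of k]]] q(1)[of k]
      by (cases "q k = 0") (auto simp: zero_ereal_def)
    then have "AE x in M. \<forall>k. q k = 0 \<longrightarrow> x \<notin> B_set M (\<nu> k)"
      by (simp add: AE_all_countable)
    with cond_a show ?thesis
    proof (rule AE_mp[OF _ AE_mp[OF _ AE_I2]], intro impI allI)
      fix x k n
      assume x: "x \<in> space M" and c: "\<forall>k n. cond_mart M F (a k) n x = g k n x / \<mu> k"
        and z: "\<forall>k. q k = 0 \<longrightarrow> x \<notin> B_set M (\<nu> k)"
      show "\<mu> k * cond_mart M F (a k) n x = g k n x"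
      proof (cases "q k = 0")
        case True
        with z x have "\<nu> k x = \<infinity>" by (auto simp: B_set_def)
        then show ?thesis using g_0[OF x, of n k] True by (simp add: \<mu>)
      qed (use c \<theta>[of k] in \<open>simp add: \<mu>\<close>)
    qed
  qed
  then have "AE x in M. \<forall>n. ((\<lambda>k. \<mu> k * cond_mart M F (a k) n x) has_sum f n x) UNIV"
    using major martingaleD(5)[OF f]
  proof (rule AE_mp[OF _ AE_mp[OF _ AE_mp[OF _ AE_I2]]], intro impI allI)
    fix x n
    assume x: "x \<in> space M" and eq: "\<forall>k n. \<mu> k * cond_mart M F (a k) n x = g k n x"
      and maj: "\<forall>n\<ge>1. U f n x \<le> l (n - 1) x" and f0: "f 0 x = 0"
    \<comment> \<open>The increments of \<open>f\<close> are added one at a time; in each of them at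
      most one level \<open>k\<close> contributes.\<close>
    have "((\<lambda>k. g k n x) has_sum f n x) UNIV"
    proof (induction n)
      case 0
      then show ?case by (simp add: g_def f0)
    next
      case (Suc n)
      have "((\<lambda>k. w k n x * (f (Suc n) x - f n x)) has_sum (f (Suc n) x - f n x)) UNIV"
      proof (cases "l n x = 0")
        case True
        \<comment> \<open>With \<open>l n x = 0\<close> no level is active, as every
          \<open>\<theta> k\<close> is positive. The increment itself must vanish, and it does
          because \<open>U f\<close> is zero through time \<open>Suc n\<close>.\<close>
        have "U f m x = 0" if "m \<le> Suc n" for m
        proof (cases "m = 0")
          case False
          then have "U f m x \<le> l (m - 1) x" using maj by simp
          also have "\<dots> \<le> l n x" using that by (intro incseqD[OF l_inc[OF x]]) auto
          finally show ?thesis using True U_nonneg[of f m x] by simp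
        qed (use U_eq_0[of 0 f x] f0 in auto)
        then have "f (Suc n) x = f n x" by (intro U_increment) auto
        then show ?thesis by simp
      next
        case False
        then have "l n x > 0" using l_nonneg[OF x, of n] by simp
        then obtain k where k: "\<theta> k < l n x" "l n x \<le> 2 * \<theta> k"
          and uniq: "\<And>j. \<theta> j < l n x \<Longrightarrow> l n x \<le> 2 * \<theta> j \<Longrightarrow> j = k"
          using exists_unique_dyadic_level[of "C / 3" "l n x"] C_pos unfolding \<theta>_def by auto
        show ?thesis
          by (rule has_sum_finite_neutralI[of "{k}"])
            (auto simp: w_def indicator_def k dest: uniq)
      qed
      from has_sum_add[OF Suc this] show ?case
        by (simp add: g_def martingale_transform_Suc)
    qed
    then show "((\<lambda>k. \<mu> k * cond_mart M F (a k) n x) has_sum f n x) UNIV"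
      using eq by simp
  qed
  then have "atomic_decomp T M F \<phi> C f a \<nu>"
    using atom by (simp add: atomic_decomp_def AE_all_countable flip: \<mu>_def)
  moreover have "(SUP k. phi_meas M \<phi> (B_set M (\<nu> k)) (2 powi k / (r / (C / 3)))) \<le> 1"
    if r: "r > 0" and bound: "(SUP \<alpha>\<in>{0<..}. phi_meas M \<phi> {x \<in> space M. \<bar>seq_limit l x\<bar> > ereal \<alpha>} (\<alpha> / r)) \<le> 1" for r
  proof (rule SUP_least)
    fix k
    \<comment> \<open>The admissibility of \<open>r\<close> is used at
      \<open>\<alpha> = \<theta> k\<close>, where \<open>\<theta> k / r\<close> equals
      \<open>2 powi k / (r / (C / 3))\<close>.\<close>
    have "B_set M (\<nu> k) \<subseteq> {x \<in> space M. \<bar>seq_limit l x\<bar> > ereal (\<theta> k)}"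
    proof
      fix x assume "x \<in> B_set M (\<nu> k)"
      then obtain n where x: "x \<in> space M" and n: "\<theta> k < l n x" by (auto simp: B_eq)
      have "ereal (\<theta> k) < ereal (l n x)" using n by simp
      also have "\<dots> \<le> seq_limit l x"
        unfolding seq_limit_eq_SUP[of l, OF l_inc[OF x]] by (rule SUP_upper) simp
      also have "\<dots> \<le> \<bar>seq_limit l x\<bar>" by (cases "seq_limit l x") auto
      finally show "x \<in> {x \<in> space M. \<bar>seq_limit l x\<bar> > ereal (\<theta> k)}" using x by simp
    qed
    then have "phi_meas M \<phi> (B_set M (\<nu> k)) (2 powi k / (r / (C / 3))) \<le>
        phi_meas M \<phi> {x \<in> space M. \<bar>seq_limit l x\<bar> > ereal (\<theta> k)} (\<theta> k / r)"
      using C_pos r by (intro phi_meas_mono) (auto simp: \<theta>_def mult.commute)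
    also have "\<dots> \<le> 1" using bound \<theta>[of k] by (auto simp: SUP_le_iff)
    finally show "phi_meas M \<phi> (B_set M (\<nu> k)) (2 powi k / (r / (C / 3))) \<le> 1" .
  qed
  ultimately show thesis by (rule that)
qed

text \<open>The two constructions give the comparison constants \<open>C / 3\<close> and
  \<open>2 * C * tail_const\<close>. The upper bound is proved for every process, the lower one for
  martingales; together they also identify the sets.\<close>

lemma atomic_characterization:
  defines "N \<equiv> \<lambda>f. INF l\<in>majorants \<phi> f. WL_norm M \<phi> (seq_limit l)"
  shows "{f \<in> martingales0 M F. N f < \<infinity>} = WH_at T M F \<phi> C"
    and "equiv_on {f \<in> martingales0 M F. N f < \<infinity>} N (WH_at_norm T M F \<phi> C)"
proof -
  let ?W = "WH_at_norm T M F \<phi> C"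
  let ?K = "2 * C * tail_const"
  have K: "?K > 0" using C_pos tail_const(1) by simp
  have upper: "N f \<le> ereal ?K * ?W f" for f
  proof -
    \<comment> \<open>Dividing first leaves the infimum alone on the right, where it is bounded
      below term by term; a process without decompositions is covered too.\<close>
    have "N f / ereal ?K \<le> ?W f"
      unfolding WH_at_norm_def
    proof (intro Inf_greatest, clarsimp, intro Inf_greatest, clarsimp)
      fix a \<nu> r
      assume "atomic_decomp T M F \<phi> C f a \<nu>" "r > 0"
        "(SUP k. phi_meas M \<phi> (B_set M (\<nu> k)) (2 powi k / r)) \<le> 1"
      then obtain l where "l \<in> majorants \<phi> f" "WL_norm M \<phi> (seq_limit l) \<le> ereal (?K * r)"
        by (rule majorant_of_decomposition)
      then have "N f \<le> ereal (?K * r)"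
        unfolding N_def by (intro INF_lower2)
      then show "N f / ereal ?K \<le> ereal r"
        using K by (subst ereal_divide_le_pos) (auto simp: mult.commute)
    qed
    then show ?thesis using K by (subst (asm) ereal_divide_le_pos) auto
  qed
  have lower: "ereal (C / 3) * ?W f \<le> N f" if f: "f \<in> martingales0 M F" for f
    unfolding N_def
  proof (rule INF_greatest)
    fix l assume "l \<in> majorants \<phi> f"
    from decomposition_of_majorant[OF f this] obtain a \<nu> where
      dec: "atomic_decomp T M F \<phi> C f a \<nu>" and
      adm: "\<And>r. r > 0 \<Longrightarrow> (SUP \<alpha>\<in>{0<..}. phi_meas M \<phi> {x \<in> space M. \<bar>seq_limit l x\<bar> > ereal \<alpha>} (\<alpha> / r)) \<le> 1 \<Longrightarrow>
        (SUP k. phi_meas M \<phi> (B_set M (\<nu> k)) (2 powi k / (r / (C / 3)))) \<le> 1"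
      by blast
    show "ereal (C / 3) * ?W f \<le> WL_norm M \<phi> (seq_limit l)"
      unfolding WL_norm_def
    proof (intro Inf_greatest, clarify)
      fix r :: real
      assume r: "r > 0"
        and bound: "(SUP \<alpha>\<in>{0<..}. phi_meas M \<phi> {x \<in> space M. \<bar>seq_limit l x\<bar> > ereal \<alpha>} (\<alpha> / r)) \<le> 1"
      have "?W f \<le> Inf {ereal s |s. s > 0 \<and> (SUP k. phi_meas M \<phi> (B_set M (\<nu> k)) (2 powi k / s)) \<le> 1}"
        unfolding WH_at_norm_def using dec by (intro Inf_lower) blast
      also have "\<dots> \<le> ereal (r / (C / 3))"
        using adm[OF r bound] r C_pos by (intro Inf_lower CollectI exI[of _ "r / (C / 3)"] conjI) auto
      finally have "ereal (C / 3) * ?W f \<le> ereal (C / 3) * ereal (r / (C / 3))"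
        using C_pos by (intro ereal_mult_left_mono) auto
      also have "\<dots> = ereal r" using C_pos by simp
      finally show "ereal (C / 3) * ?W f \<le> ereal r" .
    qed
  qed
  show "{f \<in> martingales0 M F. N f < \<infinity>} = WH_at T M F \<phi> C"
  proof (intro set_eqI iffI)
    fix f assume "f \<in> {f \<in> martingales0 M F. N f < \<infinity>}"
    then have f: "f \<in> martingales0 M F" and fin: "N f < \<infinity>" by auto
    \<comment> \<open>An infimum over the empty set is infinite, so finiteness provides a
      majorant.\<close>
    from fin obtain l where "l \<in> majorants \<phi> f" unfolding N_def INF_less_iff by blast
    with f have "\<exists>a \<nu>. atomic_decomp T M F \<phi> C f a \<nu>" by (metis decomposition_of_majorant)
    moreover have "?W f < \<infinity>"
      using le_less_trans[OF lower[OF f] fin] C_pos by (cases "?W f") auto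
    ultimately show "f \<in> WH_at T M F \<phi> C" using f by (simp add: WH_at_def)
  next
    fix f assume "f \<in> WH_at T M F \<phi> C"
    then have f: "f \<in> martingales0 M F" and fin: "?W f < \<infinity>" by (auto simp: WH_at_def)
    from fin have "ereal ?K * ?W f < \<infinity>" using K by (cases "?W f") auto
    with upper[of f] have "N f < \<infinity>" by (rule le_less_trans)
    with f show "f \<in> {f \<in> martingales0 M F. N f < \<infinity>}" by blast
  qed
  show "equiv_on {f \<in> martingales0 M F. N f < \<infinity>} N ?W"
    unfolding equiv_on_def
    using K C_pos upper lower by (intro exI[of _ "C / 3"] exI[of _ ?K] conjI) auto
qed

end

section \<open>The maximal and the square function\<close>

text \<open>The transform follows \<open>f\<close> until \<open>l\<close> exceeds \<open>t\<close>
  and is frozen from then on. A step from \<open>n\<close> to \<open>Suc n\<close> is taken only if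
  \<open>l n x \<le> t\<close>, and by predictability this already bounds
  \<open>f (Suc n) x\<close>.\<close>

lemma stopped_martingale_bound:
  assumes f0: "f 0 x = 0" and l: "incseq (\<lambda>n. l n x)"
    and bound: "\<And>n. n \<ge> 1 \<Longrightarrow> \<bar>f n x\<bar> \<le> l (n - 1) x" and "t \<ge> 0"
  shows "\<bar>martingale_transform (\<lambda>i y. indicator {..t} (l i y)) f n x\<bar> \<le> t"
proof -
  let ?h = "martingale_transform (\<lambda>i y. indicator {..t} (l i y)) f"
  have eq: "?h n x = f n x" if "\<And>i. i < n \<Longrightarrow> l i x \<le> t" for n
    using that
  proof (induction n)
    case (Suc n)
    from Suc.IH Suc.prems[of n] Suc.prems show ?case by (simp add: martingale_transform_Suc)
  qed (simp add: f0)
  show ?thesis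
  proof (induction n)
    case (Suc n)
    show ?case
    proof (cases "l n x \<le> t")
      case True
      then have "l i x \<le> t" if "i < Suc n" for i
        using incseqD[OF l, of i n] that by simp
      then have "?h (Suc n) x = f (Suc n) x" by (rule eq)
      with bound[of "Suc n"] True show ?thesis by simp
    qed (use Suc in \<open>simp add: martingale_transform_Suc\<close>)
  qed (use \<open>t \<ge> 0\<close> in simp)
qed

lemma (in prob_filtration) maximal_size_operator:
  "size_operator M F maximal_fn (\<lambda>g n x. \<bar>g n x\<bar>)"
proof
  fix f :: "nat \<Rightarrow> 'a \<Rightarrow> real" and x and l :: "nat \<Rightarrow> 'a \<Rightarrow> real" and \<theta> :: real and n
  assume *: "f 0 x = 0" "incseq (\<lambda>n. l n x)" "\<And>n. n \<ge> 1 \<Longrightarrow> \<bar>f n x\<bar> \<le> l (n - 1) x" "\<theta> \<ge> 0"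
  let ?h = "\<lambda>t. martingale_transform (\<lambda>i y. indicator {..t} (l i y)) f n x"
  \<comment> \<open>The slice is the difference of two stopped versions of \<open>f\<close>, of
    sizes \<open>2 * \<theta>\<close> and \<open>\<theta>\<close>; hence the constant 3.\<close>
  have "martingale_transform (\<lambda>i y. indicator {\<theta><..2 * \<theta>} (l i y)) f n x = ?h (2 * \<theta>) - ?h \<theta>"
    unfolding martingale_transform_def sum_subtractf[symmetric]
    using \<open>\<theta> \<ge> 0\<close> by (intro sum.cong) (auto simp: indicator_def)
  moreover have "\<bar>?h (2 * \<theta>)\<bar> \<le> 2 * \<theta>" "\<bar>?h \<theta>\<bar> \<le> \<theta>"
    using * by (auto intro!: stopped_martingale_bound)
  ultimately show "\<bar>martingale_transform (\<lambda>i y. indicator {\<theta><..2 * \<theta>} (l i y)) f n x\<bar> \<le> 3 * \<theta>"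
    by linarith
next
  fix g :: "nat \<Rightarrow> 'a \<Rightarrow> real" and K :: real and n
  assume g: "g \<in> martingales0 M F" and K: "AE x in M. \<forall>n. \<bar>g n x\<bar> \<le> K"
  note [measurable] = martingaleD(2)[OF g]
  have le: "AE x in M. (g n x)\<^sup>2 \<le> K\<^sup>2"
    using K by eventually_elim (metis abs_ge_zero power2_abs power_mono)
  have int: "integrable M (\<lambda>x. (g n x)\<^sup>2)"
    using le by (intro integrable_const_bound[of _ "K\<^sup>2"]) auto
  moreover have "(\<integral>x. (g n x)\<^sup>2 \<partial>M) \<le> (\<integral>x. K\<^sup>2 \<partial>M)"
    using int le by (intro integral_mono_AE) auto
  ultimately show "integrable M (\<lambda>x. (g n x)\<^sup>2) \<and> (\<integral>x. (g n x)\<^sup>2 \<partial>M) \<le> K\<^sup>2"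
    by (simp add: prob_space)
qed (auto simp: maximal_fn_def abs_mult intro: tendsto_rabs abs_triangle_ineq)

section \<open>The square function\<close>

lemma square_fn_upto_0 [simp]: "square_fn_upto f 0 x = 0"
  by (simp add: square_fn_upto_def)

lemma square_fn_upto_nonneg: "0 \<le> square_fn_upto f n x"
  by (simp add: square_fn_upto_def sum_nonneg)

lemma square_fn_upto_sq: "(square_fn_upto f n x)\<^sup>2 = (\<Sum>i=1..n. (mdiff f i x)\<^sup>2)"
  by (simp add: square_fn_upto_def sum_nonneg)

lemma square_fn_upto_sq_Suc:
  "(square_fn_upto f (Suc n) x)\<^sup>2 = (square_fn_upto f n x)\<^sup>2 + (f (Suc n) x - f n x)\<^sup>2"
  by (simp add: square_fn_upto_sq mdiff_def)

text \<open>In the case without summability the supremum is infinite as well, since a bound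
  \<open>b\<close> on the partial square functions would bound the partial sums by the square of
  \<open>b\<close>.\<close>

lemma square_fn_eq_SUP: "square_fn f x = (SUP n. ereal (square_fn_upto f n x))"
proof -
  let ?s = "\<lambda>i. \<bar>mdiff f (Suc i) x\<bar>\<^sup>2"
  have eq: "square_fn_upto f n x = sqrt (\<Sum>i<n. ?s i)" for n
    by (simp add: square_fn_upto_def sum.atLeast1_atMost_eq)
  have inc: "incseq (\<lambda>n. ereal (square_fn_upto f n x))"
    unfolding eq by (intro monoI ereal_less_eq(3)[THEN iffD2] real_sqrt_le_mono sum_mono2) auto
  show ?thesis
  proof (cases "summable ?s")
    case True
    then have "(\<lambda>n. ereal (square_fn_upto f n x)) \<longlonglongrightarrow> ereal (sqrt (suminf ?s))"
      unfolding eq by (intro tendsto_intros summable_LIMSEQ)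
    moreover have "(\<lambda>n. ereal (square_fn_upto f n x)) \<longlonglongrightarrow> (SUP n. ereal (square_fn_upto f n x))"
      by (rule LIMSEQ_SUP[OF inc])
    ultimately have "ereal (sqrt (suminf ?s)) = (SUP n. ereal (square_fn_upto f n x))"
      by (rule LIMSEQ_unique)
    then show ?thesis using True by (simp add: square_fn_def)
  next
    case False
    have "(SUP n. ereal (square_fn_upto f n x)) = \<infinity>"
    proof (rule ccontr)
      assume "(SUP n. ereal (square_fn_upto f n x)) \<noteq> \<infinity>"
      moreover have "ereal (square_fn_upto f n x) \<le> (SUP n. ereal (square_fn_upto f n x))" for n
        by (rule SUP_upper) simp
      ultimately obtain b where b: "\<And>n. square_fn_upto f n x \<le> b"
        by (cases "SUP n. ereal (square_fn_upto f n x)") auto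
      have "(\<Sum>i<n. ?s i) \<le> b\<^sup>2" for n
        using power_mono[OF b square_fn_upto_nonneg, of n 2] by (simp add: eq sum_nonneg)
      then have "summable ?s" by (intro summableI_nonneg_bounded) auto
      with False show False ..
    qed
    with False show ?thesis by (simp add: square_fn_def)
  qed
qed

lemma square_fn_upto_L2_set: "square_fn_upto f n x = L2_set (\<lambda>i. mdiff f i x) {1..n}"
  by (simp add: square_fn_upto_def L2_set_def)

text \<open>Inactive steps leave the square function unchanged. After an active step at
  \<open>n\<close> it is at most that of \<open>f\<close> at \<open>Suc n\<close>, which
  \<open>l n x \<le> t\<close> dominates.\<close>

lemma square_fn_upto_transform_le:
  assumes l: "incseq (\<lambda>n. l n x)" and bound: "\<And>n. n \<ge> 1 \<Longrightarrow> square_fn_upto f n x \<le> l (n - 1) x"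
    and "t \<ge> 0" and sub: "A \<subseteq> {..t}"
  shows "square_fn_upto (martingale_transform (\<lambda>i y. indicator A (l i y)) f) n x \<le> t"
proof -
  let ?g = "martingale_transform (\<lambda>i y. indicator A (l i y)) f"
  have "(square_fn_upto ?g n x)\<^sup>2 \<le> t\<^sup>2"
  proof (induction n)
    case (Suc n)
    show ?case
    proof (cases "l n x \<in> A")
      case True
      have "(square_fn_upto ?g (Suc n) x)\<^sup>2 \<le> (square_fn_upto f (Suc n) x)\<^sup>2"
        unfolding square_fn_upto_sq
        by (intro sum_mono) (auto simp: mdiff_martingale_transform indicator_def)
      also have "\<dots> \<le> t\<^sup>2"
        using bound[of "Suc n"] True sub by (intro power_mono square_fn_upto_nonneg) auto
      finally show ?thesis .
    qed (use Suc in \<open>simp add: square_fn_upto_sq_Suc martingale_transform_Suc\<close>)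
  qed simp
  then show ?thesis using \<open>t \<ge> 0\<close> by (rule power2_le_imp_le)
qed

text \<open>By orthogonality of the increments, \<open>g n\<close> and
  \<open>square_fn_upto g n\<close> have equal second moments.\<close>

lemma (in prob_filtration) square_fn_L2:
  assumes g: "g \<in> martingales0 M F" and K: "AE x in M. \<forall>n. square_fn_upto g n x \<le> K"
  shows "integrable M (\<lambda>x. (g n x)\<^sup>2) \<and> (\<integral>x. (g n x)\<^sup>2 \<partial>M) \<le> K\<^sup>2"
proof -
  note [measurable] = martingaleD(2)[OF g]
  \<comment> \<open>A crude bound that grows with \<open>n\<close>: each increment is at most the
    square function. It serves to make \<open>g n\<close> square integrable, so that orthogonality
    can be used.\<close>
  have "AE x in M. \<bar>g n x\<bar> \<le> real n * K" for n
    using K martingaleD(5)[OF g]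
  proof eventually_elim
    case (elim x)
    show ?case
    proof (induction n)
      case (Suc n)
      have "(g (Suc n) x - g n x)\<^sup>2 \<le> (square_fn_upto g (Suc n) x)\<^sup>2"
        by (simp add: square_fn_upto_sq_Suc)
      then have "\<bar>g (Suc n) x - g n x\<bar> \<le> \<bar>square_fn_upto g (Suc n) x\<bar>"
        by (simp only: abs_le_square_iff)
      also have "\<dots> = square_fn_upto g (Suc n) x" by (simp add: square_fn_upto_nonneg)
      also have "\<dots> \<le> K" using elim(1) by blast
      finally show ?case using Suc by (simp add: algebra_simps)
    qed (simp add: elim(2))
  qed
  then have "AE x in M. norm ((g n x)\<^sup>2) \<le> (real n * K)\<^sup>2" for n
  proof (rule AE_mp[OF _ AE_I2], intro impI)
    fix x assume "\<bar>g n x\<bar> \<le> real n * K"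
    from power_mono[OF this, of 2] show "norm ((g n x)\<^sup>2) \<le> (real n * K)\<^sup>2" by simp
  qed
  then have sq: "integrable M (\<lambda>x. (g n x)\<^sup>2)" for n
    by (intro integrable_const_bound) auto
  note incr = L2_martingale_increment[OF g sq]
  have eq: "integrable M (\<lambda>x. (square_fn_upto g n x)\<^sup>2) \<and>
      (\<integral>x. (g n x)\<^sup>2 \<partial>M) = (\<integral>x. (square_fn_upto g n x)\<^sup>2 \<partial>M)" for n
  proof (induction n)
    case 0
    have "(\<integral>x. (g 0 x)\<^sup>2 \<partial>M) = (\<integral>x. 0 \<partial>M)"
      using martingaleD(5)[OF g] by (intro integral_cong_AE) auto
    then show ?case by simp
  next
    case (Suc n)
    then show ?case
      using incr(1)[of "Suc n" n] incr(2)[of n "Suc n"] by (simp add: square_fn_upto_sq_Suc)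
  qed
  have "(\<integral>x. (square_fn_upto g n x)\<^sup>2 \<partial>M) \<le> (\<integral>x. K\<^sup>2 \<partial>M)"
  proof (rule integral_mono_AE)
    show "AE x in M. (square_fn_upto g n x)\<^sup>2 \<le> K\<^sup>2"
      using K by eventually_elim (intro power_mono square_fn_upto_nonneg, auto)
  qed (use eq in auto)
  then show ?thesis using sq eq by (simp add: prob_space)
qed

lemma (in prob_filtration) square_size_operator:
  "size_operator M F square_fn square_fn_upto"
proof
  fix f :: "nat \<Rightarrow> 'a \<Rightarrow> real" and n x
  assume "square_fn_upto f n x = 0" "square_fn_upto f (Suc n) x = 0"
  then show "f (Suc n) x = f n x" using square_fn_upto_sq_Suc[of f n x] by simp
next
  fix f :: "nat \<Rightarrow> 'a \<Rightarrow> real" and x and l :: "nat \<Rightarrow> 'a \<Rightarrow> real" and \<theta> :: real and n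
  assume *: "incseq (\<lambda>n. l n x)" "\<And>n. n \<ge> 1 \<Longrightarrow> square_fn_upto f n x \<le> l (n - 1) x" "\<theta> \<ge> 0"
  \<comment> \<open>The square function needs no splitting into stopped parts; its bound
    \<open>2 * \<theta>\<close> is relaxed to the common \<open>3 * \<theta>\<close>.\<close>
  have "square_fn_upto (martingale_transform (\<lambda>i y. indicator {\<theta><..2 * \<theta>} (l i y)) f) n x \<le> 2 * \<theta>"
    using * by (intro square_fn_upto_transform_le) auto
  with \<open>\<theta> \<ge> 0\<close> show
    "square_fn_upto (martingale_transform (\<lambda>i y. indicator {\<theta><..2 * \<theta>} (l i y)) f) n x \<le> 3 * \<theta>"
    by linarith
next
  fix g h :: "nat \<Rightarrow> 'a \<Rightarrow> real" and n x
  \<comment> \<open>Taking increments is additive, so the triangle inequality is that of the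
    Euclidean norm.\<close>
  have "(\<lambda>i. mdiff (\<lambda>i x. g i x + h i x) i x) = (\<lambda>i. mdiff g i x + mdiff h i x)"
    by (simp add: mdiff_def fun_eq_iff)
  then show "square_fn_upto (\<lambda>i x. g i x + h i x) n x \<le> square_fn_upto g n x + square_fn_upto h n x"
    by (simp add: square_fn_upto_L2_set L2_set_triangle_ineq)
next
  fix r and g :: "nat \<Rightarrow> 'a \<Rightarrow> real" and n x
  have "(square_fn_upto (\<lambda>i x. r * g i x) n x)\<^sup>2 = (\<bar>r\<bar> * square_fn_upto g n x)\<^sup>2"
    by (simp add: square_fn_upto_sq power_mult_distrib mdiff_def sum_distrib_left flip: right_diff_distrib)
  then show "square_fn_upto (\<lambda>i x. r * g i x) n x = \<bar>r\<bar> * square_fn_upto g n x"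
    by (rule power2_eq_imp_eq) (simp_all add: square_fn_upto_nonneg)
next
  fix G :: "nat \<Rightarrow> nat \<Rightarrow> 'a \<Rightarrow> real" and g n x
  assume "\<And>i. i \<le> n \<Longrightarrow> (\<lambda>N. G N i x) \<longlonglongrightarrow> g i x"
  then show "(\<lambda>N. square_fn_upto (G N) n x) \<longlonglongrightarrow> square_fn_upto g n x"
    unfolding square_fn_upto_def mdiff_def by (intro tendsto_intros) auto
next
  fix g :: "nat \<Rightarrow> 'a \<Rightarrow> real" and n
  assume [measurable]: "\<And>i. g i \<in> borel_measurable M"
  show "square_fn_upto g n \<in> borel_measurable M"
    unfolding square_fn_upto_def[abs_def] mdiff_def by measurable
qed (fact square_fn_eq_SUP square_fn_upto_nonneg square_fn_L2)+

theorem theorem3p2: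
  fixes M :: "'a measure" and F :: "nat \<Rightarrow> 'a measure"
    and \<phi> :: "'a \<Rightarrow> real \<Rightarrow> real" and p_minus p_plus C :: real
  assumes "prob_space M"
    and "filtration (space M) F"
    and "\<And>n. subalgebra M (F n)"
    and "musielak_orlicz M \<phi>"
    and "\<And>t. t > 0 \<Longrightarrow> (\<integral>\<^sup>+x. ennreal (\<phi> x t) \<partial>M) < \<infinity>"
    and "p_minus > 0" and "unif_lower_type M \<phi> p_minus"
    and "p_plus > 0" and "unif_upper_type M \<phi> p_plus"
    and "C > 0"
  shows "WP M F \<phi> = WH_at maximal_fn M F \<phi> C \<and>
         equiv_on (WP M F \<phi>) (WP_norm M F \<phi>) (WH_at_norm maximal_fn M F \<phi> C) \<and>
         WQ M F \<phi> = WH_at square_fn M F \<phi> C \<and>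
         equiv_on (WQ M F \<phi>) (WQ_norm M F \<phi>) (WH_at_norm square_fn M F \<phi> C)"
proof -
  from assms(7) obtain c where c: "c > 0" and lower: "\<And>x t s. x \<in> space M \<Longrightarrow> t \<ge> 0 \<Longrightarrow>
      s \<in> {0<..<1} \<Longrightarrow> \<phi> x (s * t) \<le> c * s powr p_minus * \<phi> x t"
    by (auto simp: unif_lower_type_def)
  interpret prob_filtration M F
    using assms(1-3) by (intro prob_filtration.intro prob_filtration_axioms.intro)
  interpret musielak_orlicz_filtration M F \<phi> c p_minus
    using assms(4-6) c lower by unfold_locales auto
  interpret P: size_operator M F maximal_fn "\<lambda>g n x. \<bar>g n x\<bar>"
    by (rule maximal_size_operator)
  interpret Q: size_operator M F square_fn square_fn_upto
    by (rule square_size_operator)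
  interpret P: atomic_setting M F \<phi> c p_minus maximal_fn "\<lambda>g n x. \<bar>g n x\<bar>" C
    by unfold_locales fact
  interpret Q: atomic_setting M F \<phi> c p_minus square_fn square_fn_upto C
    by unfold_locales fact
  have P: "WP_norm M F \<phi> = (\<lambda>f. INF l\<in>P.majorants \<phi> f. WL_norm M \<phi> (seq_limit l))"
    by (simp add: WP_norm_def[abs_def] Lambda_WP_def P.majorants_def)
  have Q: "WQ_norm M F \<phi> = (\<lambda>f. INF l\<in>Q.majorants \<phi> f. WL_norm M \<phi> (seq_limit l))"
    by (simp add: WQ_norm_def[abs_def] Lambda_WQ_def Q.majorants_def)
  show ?thesis
    unfolding WP_def WQ_def P Q
    using P.atomic_characterization Q.atomic_characterization by blast
qed

end
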